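(* Let $\mathcal H$ be a vector sublattice of $L^\Phi(\mathfrak P)$ that contains $\mathbf 1_\Omega$ and generates $\mathcal F$, let $\mathcal C=\mathrm{cl}(\mathcal H)$ be its norm closure in $L^\Phi(\mathfrak P)$, and assume $L^\infty(\mathfrak P)\subset L^\Phi(\mathfrak P)$. The following statements are equivalent: (1) $\mathcal C$ is Dedekind $\sigma$-complete and $\mathfrak P\approx\mathbf{ca}_+^\sigma(\mathcal C)$. (2) $\mathcal C$ is Dedekind $\sigma$-complete and $\mathbf{ca}(\mathcal C)=\mathbf{ca}^\sigma(\mathcal C)$. (3) $\mathcal C$ is an ideal in $L^\Phi(\mathfrak P)$. If $\mathcal H\subset L^\infty(\mathfrak P)$, (1)–(3) are furthermore equivalent to: (4) $\mathcal C=\mathrm{cl}(L^\infty(\mathfrak P))$.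
   Context: $(\Omega,\mathcal F)$ is a measurable space, $\mathfrak P$ a nonempty set of probability measures on it. $L^0(\mathfrak P)$ is the space of equivalence classes $[f]$ of measurable $f\colon\Omega\to\mathbb R$ under $f\sim g\iff \mathbb P(f=g)=1$ for all $\mathbb P\in\mathfrak P$, with the order $X\preceq Y$ iff $\mathbb P(f\le g)=1$ for all $\mathbb P\in\mathfrak P$, $f\in X$, $g\in Y$; it is a vector lattice. $L^\infty(\mathfrak P)\subset L^0(\mathfrak P)$ is the space of classes of bounded random variables. An Orlicz function is a lower semicontinuous, nondecreasing, convex $\phi\colon[0,\infty)\to[0,\infty]$ with $\phi(0)=0$ such that there are $x_0,x_1>0$ with $\phi(x_0)<\infty$, $\phi(x_1)>0$. $\Phi=(\phi_{\mathbb P})_{\mathbb P\in\mathfrak P}$ is a family of Orlicz functions; for $X\in L^0(\mathfrak P)$, $\|X\|_{L^\Phi(\mathfrak P)}=\inf\{\lambda>0:\sup_{\mathbb P\in\mathfrak P}\mathbb E_{\mathbb P}[\phi_{\mathbb P}(\lambda^{-1}|X|)]\le1\}$, and $L^\Phi(\mathfrak P)=\{X: \|X\|_{L^\Phi(\mathfrak P)}<\infty\}$; this is a Banach lattice. Closures cl are in this norm. Standing assumption: $L^\infty(\mathfrak P)\subset L^\Phi(\mathfrak P)$. $\mathcal H$ generates $\mathcal F$ if the $\sigma$-algebra generated by $\{f\colon\Omega\to\mathbb R\text{ measurable}: [f]\in\mathcal H\}$ equals $\mathcal F$. $\mathbf{ca}$: signed measures on $(\Omega,\mathcal F)$ of finite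 total variation; $\mathbf{ca}_+$: finite measures. For nonempty $\mathfrak Q,\mathfrak R\subset\mathbf{ca}$, $\mathfrak Q\ll\mathfrak R$ means $\sup_{\nu\in\mathfrak R}|\nu|(N)=0$ implies $\sup_{\mu\in\mathfrak Q}|\mu|(N)=0$ for $N\in\mathcal F$; $\mathfrak Q\approx\mathfrak R$ means $\mathfrak Q\ll\mathfrak R$ and $\mathfrak R\ll\mathfrak Q$. $\mathbf{ca}(\mathfrak P)=\{\mu\in\mathbf{ca}:\mu\ll\mathfrak P\}$. $\mathbf{ca}(\mathcal C)$ is the set of $\mu\in\mathbf{ca}(\mathfrak P)$ such that every $X\in\mathcal C$ is $|\mu|$-integrable and $X\mapsto\int X\,d|\mu|$ is norm continuous on $\mathcal C$. A functional $\ell\colon\mathcal X\to\mathbb R$ on a vector lattice is $\sigma$-order continuous if (i) $\{\ell(z): x\preceq z\preceq y\}$ is bounded for all $x,y\in\mathcal X$, and (ii) $\lim_n|\ell(x_n)|=0$ for all sequences $(x_n)\subset\mathcal X$ for which there is $(y_n)\subset\mathcal X_+$ with $|x_n|\preceq y_n$ for all $n$ and $y_n\downarrow0$ (i.e. $y_{n+1}\preceq y_n$ and $\inf_ny_n=0$ in $\mathcal X$). Every $\sigma$-order continuous linear functional on $\mathcal C$ is of the form $X\mapsto\int X\,d\mu$ for a unique $\mu\in\mathbf{ca}(\mathfrak P)$ for which all $X\in\mathcal C$ are $|\mu|$-integrable; $\mathbf{ca}^\sigma(\mathcal C)\subset\mathbf{ca}(\mathfrak P)$ is the set of these measures and $\mathbf{ca}^\sigma_+(\mathcal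 C)=\mathbf{ca}^\sigma(\mathcal C)\cap\mathbf{ca}_+$. A vector lattice is Dedekind $\sigma$-complete if every countable subset with an upper bound has a least upper bound. An ideal $I$ in a vector lattice is a vector subspace such that $|X|\preceq|Y|$, $Y\in I$ imply $X\in I$. *)

theory Defs
  imports "HOL-Probability.Probability" "HOL-Algebra.Order"
begin

section \<open>The space of quasi-sure equivalence classes\<close>

definition qs_rel :: "'a measure \<Rightarrow> 'a measure set \<Rightarrow> (('a \<Rightarrow> real) \<times> ('a \<Rightarrow> real)) set" where
  "qs_rel M \<PP> = {(f, g). f \<in> borel_measurable M \<and> g \<in> borel_measurable M \<and>
     (\<forall>P\<in>\<PP>. AE \<omega> in P. f \<omega> = g \<omega>)}"

definition qs_class :: "'a measure \<Rightarrow> 'a measure set \<Rightarrow> ('a \<Rightarrow> real) \<Rightarrow> ('a \<Rightarrow> real) set" where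
  "qs_class M \<PP> f = qs_rel M \<PP> `` {f}"

definition L0 :: "'a measure \<Rightarrow> 'a measure set \<Rightarrow> ('a \<Rightarrow> real) set set" where
  "L0 M \<PP> = borel_measurable M // qs_rel M \<PP>"

definition Linf :: "'a measure \<Rightarrow> 'a measure set \<Rightarrow> ('a \<Rightarrow> real) set set" where
  "Linf M \<PP> = {qs_class M \<PP> f |f. f \<in> borel_measurable M \<and> bounded (f ` space M)}"

definition rep :: "('a \<Rightarrow> real) set \<Rightarrow> 'a \<Rightarrow> real" where
  "rep X = (SOME f. f \<in> X)"

text \<open>The vector lattice operations of \<^term>\<open>L0 M \<PP>\<close> are the pointwise ones on representatives.\<close>

definition qs_zero :: "'a measure \<Rightarrow> 'a measure set \<Rightarrow> ('a \<Rightarrow> real) set" where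
  "qs_zero M \<PP> = qs_class M \<PP> (\<lambda>_. 0)"

definition qs_one :: "'a measure \<Rightarrow> 'a measure set \<Rightarrow> ('a \<Rightarrow> real) set" where
  "qs_one M \<PP> = qs_class M \<PP> (\<lambda>_. 1)"

definition qs_add where
  "qs_add M \<PP> X Y = qs_class M \<PP> (\<lambda>\<omega>. rep X \<omega> + rep Y \<omega>)"

definition qs_diff where
  "qs_diff M \<PP> X Y = qs_class M \<PP> (\<lambda>\<omega>. rep X \<omega> - rep Y \<omega>)"

definition qs_scale where
  "qs_scale M \<PP> c X = qs_class M \<PP> (\<lambda>\<omega>. c * rep X \<omega>)"

definition qs_sup where
  "qs_sup M \<PP> X Y = qs_class M \<PP> (\<lambda>\<omega>. max (rep X \<omega>) (rep Y \<omega>))"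

definition qs_inf where
  "qs_inf M \<PP> X Y = qs_class M \<PP> (\<lambda>\<omega>. min (rep X \<omega>) (rep Y \<omega>))"

definition qs_abs where
  "qs_abs M \<PP> X = qs_class M \<PP> (\<lambda>\<omega>. \<bar>rep X \<omega>\<bar>)"

definition qs_le :: "'a measure set \<Rightarrow> ('a \<Rightarrow> real) set \<Rightarrow> ('a \<Rightarrow> real) set \<Rightarrow> bool" where
  "qs_le \<PP> X Y \<longleftrightarrow> (\<forall>f\<in>X. \<forall>g\<in>Y. \<forall>P\<in>\<PP>. AE \<omega> in P. f \<omega> \<le> g \<omega>)"

text \<open>Bounds, suprema and infima are always taken inside the given space \<open>\<X>\<close>, not in the
  ambient space \<^term>\<open>L0 M \<PP>\<close>.\<close>

definition qs_order :: "'a measure set \<Rightarrow> ('a \<Rightarrow> real) set set \<Rightarrow> ('a \<Rightarrow> real) set gorder" where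
  "qs_order \<PP> \<X> = \<lparr>carrier = \<X>, eq = (=), le = qs_le \<PP>\<rparr>"


section \<open>Orlicz functions and the space \<open>L\<^sup>\<Phi>\<close>\<close>

text \<open>Only the values on \<open>[0,\<infinity>)\<close> matter. Note that \<open>0 * \<infinity> = 0\<close> in \<^typ>\<open>ennreal\<close>.\<close>

definition orlicz_function :: "(real \<Rightarrow> ennreal) \<Rightarrow> bool" where
  "orlicz_function \<phi> \<longleftrightarrow>
     (\<forall>x\<ge>0. \<phi> x \<le> Liminf (at x within {0..}) \<phi>) \<and>
     mono_on {0..} \<phi> \<and>
     (\<forall>x\<ge>0. \<forall>y\<ge>0. \<forall>t\<in>{0..1}.
        \<phi> ((1 - t) * x + t * y) \<le> ennreal (1 - t) * \<phi> x + ennreal t * \<phi> y) \<and>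
     \<phi> 0 = 0 \<and> (\<exists>x\<^sub>0>0. \<phi> x\<^sub>0 < \<infinity>) \<and> (\<exists>x\<^sub>1>0. \<phi> x\<^sub>1 > 0)"

definition lux_norm ::
  "'a measure set \<Rightarrow> ('a measure \<Rightarrow> real \<Rightarrow> ennreal) \<Rightarrow> ('a \<Rightarrow> real) set \<Rightarrow> ennreal" where
  "lux_norm \<PP> \<Phi> X =
     Inf {ennreal l |l. l > 0 \<and> (SUP P\<in>\<PP>. \<integral>\<^sup>+\<omega>. \<Phi> P (inverse l * \<bar>rep X \<omega>\<bar>) \<partial>P) \<le> 1}"

definition LPhi ::
  "'a measure \<Rightarrow> 'a measure set \<Rightarrow> ('a measure \<Rightarrow> real \<Rightarrow> ennreal) \<Rightarrow> ('a \<Rightarrow> real) set set" where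
  "LPhi M \<PP> \<Phi> = {X \<in> L0 M \<PP>. lux_norm \<PP> \<Phi> X < \<infinity>}"

definition norm_closure where
  "norm_closure M \<PP> \<Phi> \<A> =
     {X \<in> LPhi M \<PP> \<Phi>. \<forall>\<epsilon>>0. \<exists>Y\<in>\<A>. lux_norm \<PP> \<Phi> (qs_diff M \<PP> X Y) < ennreal \<epsilon>}"

definition norm_continuous_on where
  "norm_continuous_on M \<PP> \<Phi> \<X> (\<l> :: ('a \<Rightarrow> real) set \<Rightarrow> real) \<longleftrightarrow>
     (\<forall>X\<in>\<X>. \<forall>\<epsilon>>0. \<exists>\<delta>>0. \<forall>Y\<in>\<X>.
        lux_norm \<PP> \<Phi> (qs_diff M \<PP> Y X) < ennreal \<delta> \<longrightarrow> \<bar>\<l> Y - \<l> X\<bar> < \<epsilon>)"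


section \<open>Lattice notions\<close>

definition vector_subspace where
  "vector_subspace M \<PP> \<X> \<U> \<longleftrightarrow> \<U> \<subseteq> \<X> \<and> qs_zero M \<PP> \<in> \<U> \<and>
     (\<forall>X\<in>\<U>. \<forall>Y\<in>\<U>. qs_add M \<PP> X Y \<in> \<U>) \<and> (\<forall>c. \<forall>X\<in>\<U>. qs_scale M \<PP> c X \<in> \<U>)"

definition vector_sublattice where
  "vector_sublattice M \<PP> \<X> \<U> \<longleftrightarrow> vector_subspace M \<PP> \<X> \<U> \<and>
     (\<forall>X\<in>\<U>. \<forall>Y\<in>\<U>. qs_sup M \<PP> X Y \<in> \<U> \<and> qs_inf M \<PP> X Y \<in> \<U>)"

definition lattice_ideal where
  "lattice_ideal M \<PP> \<X> \<I> \<longleftrightarrow> vector_subspace M \<PP> \<X> \<I> \<and>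
     (\<forall>X\<in>\<X>. \<forall>Y\<in>\<I>. qs_le \<PP> (qs_abs M \<PP> X) (qs_abs M \<PP> Y) \<longrightarrow> X \<in> \<I>)"

text \<open>The empty set has to be excluded: a least upper bound of it would be a least element,
  which no nontrivial vector lattice has.\<close>

definition dedekind_sigma_complete where
  "dedekind_sigma_complete \<PP> \<X> \<longleftrightarrow>
     (\<forall>A. A \<subseteq> \<X> \<and> A \<noteq> {} \<and> countable A \<and> Upper (qs_order \<PP> \<X>) A \<noteq> {} \<longrightarrow>
        (\<exists>S. is_lub (qs_order \<PP> \<X>) S A))"

definition sigma_order_continuous where
  "sigma_order_continuous M \<PP> \<X> (\<l> :: ('a \<Rightarrow> real) set \<Rightarrow> real) \<longleftrightarrow>
     (\<forall>X\<in>\<X>. \<forall>Y\<in>\<X>. bounded (\<l> ` {Z\<in>\<X>. qs_le \<PP> X Z \<and> qs_le \<PP> Z Y})) \<and>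
     (\<forall>X Y :: nat \<Rightarrow> ('a \<Rightarrow> real) set.
        range X \<subseteq> \<X> \<and> range Y \<subseteq> {Z\<in>\<X>. qs_le \<PP> (qs_zero M \<PP>) Z} \<and>
        (\<forall>n. qs_le \<PP> (qs_abs M \<PP> (X n)) (Y n)) \<and>
        (\<forall>n. qs_le \<PP> (Y (Suc n)) (Y n)) \<and>
        is_glb (qs_order \<PP> \<X>) (qs_zero M \<PP>) (range Y) \<longrightarrow>
        (\<lambda>n. \<bar>\<l> (X n)\<bar>) \<longlonglongrightarrow> 0)"

definition generates where
  "generates M \<PP> \<H> \<longleftrightarrow>
     sigma_sets (space M)
       {f -` B \<inter> space M |f B. f \<in> borel_measurable M \<and> qs_class M \<PP> f \<in> \<H> \<and> B \<in> sets borel}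
     = sets M"


section \<open>Signed measures\<close>

text \<open>A signed measure is a real-valued set function; it is set to 0 on nonmeasurable sets,
  as is \<^term>\<open>measure P\<close> for \<^term>\<open>P :: 'a measure\<close>, so that equality of set functions is equality
  of signed measures.\<close>

definition total_variation :: "'a measure \<Rightarrow> ('a set \<Rightarrow> real) \<Rightarrow> 'a set \<Rightarrow> ennreal" where
  "total_variation M \<mu> A =
     (SUP \<A>\<in>{\<A>. finite \<A> \<and> \<A> \<subseteq> sets M \<and> partition_on A \<A>}. \<Sum>B\<in>\<A>. ennreal \<bar>\<mu> B\<bar>)"

definition ca :: "'a measure \<Rightarrow> ('a set \<Rightarrow> real) set" where
  "ca M = {\<mu>. (\<forall>A. A \<notin> sets M \<longrightarrow> \<mu> A = 0) \<and>
     (\<forall>A :: nat \<Rightarrow> 'a set. range A \<subseteq> sets M \<longrightarrow> disjoint_family A \<longrightarrow>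
        (\<lambda>n. \<mu> (A n)) sums \<mu> (\<Union>n. A n)) \<and>
     total_variation M \<mu> (space M) < \<infinity>}"

definition ca_plus :: "'a measure \<Rightarrow> ('a set \<Rightarrow> real) set" where
  "ca_plus M = {\<mu> \<in> ca M. \<forall>A\<in>sets M. 0 \<le> \<mu> A}"

definition abs_measure :: "'a measure \<Rightarrow> ('a set \<Rightarrow> real) \<Rightarrow> 'a measure" where
  "abs_measure M \<mu> = measure_of (space M) (sets M) (total_variation M \<mu>)"

text \<open>Jordan decomposition: \<open>\<mu>\<^sup>+ = (\<bar>\<mu>\<bar> + \<mu>) / 2\<close> and \<open>\<mu>\<^sup>- = (\<bar>\<mu>\<bar> - \<mu>) / 2\<close>.\<close>

definition pos_measure :: "'a measure \<Rightarrow> ('a set \<Rightarrow> real) \<Rightarrow> 'a measure" where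
  "pos_measure M \<mu> = measure_of (space M) (sets M)
     (\<lambda>A. ennreal ((enn2real (total_variation M \<mu> A) + \<mu> A) / 2))"

definition neg_measure :: "'a measure \<Rightarrow> ('a set \<Rightarrow> real) \<Rightarrow> 'a measure" where
  "neg_measure M \<mu> = measure_of (space M) (sets M)
     (\<lambda>A. ennreal ((enn2real (total_variation M \<mu> A) - \<mu> A) / 2))"

text \<open>For \<open>\<mu> \<lless> \<PP>\<close> the following notions do not depend on the representative of \<open>X\<close>.\<close>

definition abs_integrable where
  "abs_integrable M \<mu> X \<longleftrightarrow> integrable (abs_measure M \<mu>) (rep X)"

definition abs_integral where
  "abs_integral M \<mu> X = integral\<^sup>L (abs_measure M \<mu>) (rep X)"

definition signed_integral where
  "signed_integral M \<mu> X =
     integral\<^sup>L (pos_measure M \<mu>) (rep X) - integral\<^sup>L (neg_measure M \<mu>) (rep X)"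

definition dominated :: "'a measure \<Rightarrow> ('a set \<Rightarrow> real) set \<Rightarrow> ('a set \<Rightarrow> real) set \<Rightarrow> bool" where
  "dominated M \<QQ> \<RR> \<longleftrightarrow>
     (\<forall>N\<in>sets M. (SUP \<nu>\<in>\<RR>. total_variation M \<nu> N) = 0 \<longrightarrow> (SUP \<mu>\<in>\<QQ>. total_variation M \<mu> N) = 0)"

definition equivalent :: "'a measure \<Rightarrow> ('a set \<Rightarrow> real) set \<Rightarrow> ('a set \<Rightarrow> real) set \<Rightarrow> bool" where
  "equivalent M \<QQ> \<RR> \<longleftrightarrow> dominated M \<QQ> \<RR> \<and> dominated M \<RR> \<QQ>"

definition ca_dom :: "'a measure \<Rightarrow> 'a measure set \<Rightarrow> ('a set \<Rightarrow> real) set" where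
  "ca_dom M \<PP> = {\<mu> \<in> ca M. dominated M {\<mu>} (measure ` \<PP>)}"

definition ca_cont where
  "ca_cont M \<PP> \<Phi> \<C> = {\<mu> \<in> ca_dom M \<PP>. (\<forall>X\<in>\<C>. abs_integrable M \<mu> X) \<and>
     norm_continuous_on M \<PP> \<Phi> \<C> (abs_integral M \<mu>)}"

text \<open>The measures representing the \<open>\<sigma>\<close>-order continuous linear functionals on \<open>\<C>\<close>.\<close>

definition ca_sigma where
  "ca_sigma M \<PP> \<C> = {\<mu> \<in> ca_dom M \<PP>. (\<forall>X\<in>\<C>. abs_integrable M \<mu> X) \<and>
     sigma_order_continuous M \<PP> \<C> (signed_integral M \<mu>)}"

definition ca_sigma_plus where
  "ca_sigma_plus M \<PP> \<C> = ca_sigma M \<PP> \<C> \<inter> ca_plus M"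

end

theory Submission
  imports Defs
begin

text \<open>(3) implies (2): suprema and infima of countable subsets of an ideal are pointwise, so dominated
  convergence makes \<open>X \<mapsto> \<integral>X d\<mu>\<close> \<open>\<sigma>\<close>-order continuous as soon as \<open>\<C>\<close> consists of
  \<open>|\<mu>|\<close>-integrable elements. Such \<open>\<mu>\<close> are exactly the elements of \<open>ca_cont\<close>, since positive
  functionals on the Banach lattice \<open>\<C>\<close> are continuous. (2) implies (1): every \<open>P \<in> \<PP>\<close> lies
  in \<open>ca_cont\<close>, because a linear lower bound on \<open>\<Phi> P\<close> gives \<open>E\<^sub>P |X| \<le> K \<parallel>X\<parallel>\<close>. (1) implies (3):
  testing against the measures in \<open>ca_sigma_plus\<close>, which detect all non-polar sets, shows that
  bounded monotone limits in \<open>\<C>\<close> are pointwise. Hence the sets whose indicator is in \<open>\<C>\<close> form a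
  \<open>\<sigma>\<close>-algebra, which makes the elements of \<open>\<H>\<close> measurable and hence contains \<open>sets M\<close>; nonnegative
  functions below an element of \<open>\<C>\<close> are then reached by monotone approximation. For (4), truncation
  shows that the closure of the bounded random variables is an ideal.\<close>

section \<open>Total variation\<close>

text \<open>In general no single measure dominates \<PP>, so exceptional sets are treated for all
  \<open>P\<close> at once, and only countably many quasi-sure conditions can be combined. The
  obstacle in (1) implies (3) is that bounds are taken inside \<C>. For \<open>s\<close> the least
  upper bound in \<C> of an increasing sequence \<open>f n\<close> with pointwise limit
  \<open>g\<close>, order continuity sends the integrals of \<open>s - f n\<close> to 0, so
  \<open>s - g\<close> has integral 0 under every positive order continuous measure. Indicators
  arise from elements of \<C> because the constant 1 is available:
  \<open>min 1 (n * max 0 (f - a))\<close> increases to the indicator of \<open>{f > a}\<close>.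
  Continuity of positive functionals rests on completeness of \<C>, which is used in the form of
  \<open>fn_series\<close>: a series with geometrically decaying norms converges quasi surely, and
  Fatou's lemma controls its tails.\<close>

definition signed_additive :: "'a measure \<Rightarrow> ('a set \<Rightarrow> real) \<Rightarrow> bool" where
  "signed_additive M \<mu> \<longleftrightarrow> (\<forall>A :: nat \<Rightarrow> 'a set. range A \<subseteq> sets M \<longrightarrow> disjoint_family A \<longrightarrow>
        (\<lambda>n. \<mu> (A n)) sums \<mu> (\<Union>n. A n))"

text \<open>The empty set is disjoint from itself, so the constant sequence \<open>{}\<close> is an
  admissible family, and a constant series converges only if its term is 0.\<close>

lemma signed_additive_empty:
  assumes "signed_additive M \<mu>"
  shows "\<mu> {} = 0"
proof -
  have "(\<lambda>n::nat. \<mu> {}) sums \<mu> (\<Union>n::nat. {})"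
    using assms[unfolded signed_additive_def, rule_format, of "\<lambda>_. {}"] by (auto simp: disjoint_family_on_def)
  then have "summable (\<lambda>n::nat. \<mu> {})" by (auto simp: sums_iff)
  then show ?thesis by (simp add: summable_const_iff)
qed

lemma signed_additive_Un:
  assumes \<mu>: "signed_additive M \<mu>" and AB: "A \<in> sets M" "B \<in> sets M" "A \<inter> B = {}"
  shows "\<mu> (A \<union> B) = \<mu> A + \<mu> B"
proof -
  have "disjoint_family (binaryset A B)"
    using AB by (auto simp: disjoint_family_on_def binaryset_def)
  then have "(\<lambda>n. \<mu> (binaryset A B n)) sums \<mu> (\<Union>n. binaryset A B n)"
    using AB \<mu>[unfolded signed_additive_def, rule_format, of "binaryset A B"]
    by (simp add: range_binaryset_eq)
  moreover have "(\<lambda>n. \<mu> (binaryset A B n)) sums (\<mu> A + \<mu> B)"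
    by (rule binaryset_sums) (rule signed_additive_empty[OF \<mu>])
  ultimately show ?thesis by (simp add: UN_binaryset_eq sums_iff)
qed

lemma signed_additive_Union:
  assumes \<mu>: "signed_additive M \<mu>" and "finite \<A>" "\<A> \<subseteq> sets M" "disjoint \<A>"
  shows "\<mu> (\<Union>\<A>) = (\<Sum>B\<in>\<A>. \<mu> B)"
  using assms(2-)
proof (induction)
  case empty
  then show ?case using signed_additive_empty[OF \<mu>] by simp
next
  case (insert B \<A>)
  have "\<mu> (B \<union> \<Union>\<A>) = \<mu> B + \<mu> (\<Union>\<A>)"
    using insert by (intro signed_additive_Un[OF \<mu>]) (auto simp: disjoint_def)
  with insert show ?case by (auto simp: disjoint_def)
qed

text \<open>The supremum in \<open>total_variation\<close> runs over exact partitions without empty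
  blocks. A disjoint family inside \<open>A\<close> is completed by the remainder and stripped of
  \<open>{}\<close>; since \<open>\<mu> {} = 0\<close>, neither change lowers the sum.\<close>

lemma sum_le_total_variation:
  assumes A: "A \<in> sets M" and \<A>: "finite \<A>" "\<A> \<subseteq> sets M" "disjoint \<A>" "\<Union>\<A> \<subseteq> A"
    and 0: "\<mu> {} = 0"
  shows "(\<Sum>B\<in>\<A>. ennreal \<bar>\<mu> B\<bar>) \<le> total_variation M \<mu> A"
proof -
  define \<B> where "\<B> = insert (A - \<Union>\<A>) \<A> - {{}}"
  have fin: "finite (insert (A - \<Union>\<A>) \<A>)" using \<A> by simp
  have "partition_on A \<B>"
  proof (rule partition_onI)
    show "\<Union>\<B> = A" using \<A>(4) by (auto simp: \<B>_def)
    show "disjnt p q" if "p \<in> \<B>" "q \<in> \<B>" "p \<noteq> q" for p q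
      using that disjointD[OF \<A>(3)] unfolding \<B>_def disjnt_def by blast
  qed (simp add: \<B>_def)
  moreover have "\<B> \<subseteq> sets M" using \<A> A by (auto simp: \<B>_def)
  ultimately have "(\<Sum>B\<in>\<B>. ennreal \<bar>\<mu> B\<bar>) \<le> total_variation M \<mu> A"
    unfolding total_variation_def using fin by (intro SUP_upper) (auto simp: \<B>_def)
  moreover have "(\<Sum>B\<in>\<B>. ennreal \<bar>\<mu> B\<bar>) = (\<Sum>B\<in>insert (A - \<Union>\<A>) \<A>. ennreal \<bar>\<mu> B\<bar>)"
    using fin 0 by (intro sum.mono_neutral_left) (auto simp: \<B>_def)
  moreover have "(\<Sum>B\<in>\<A>. ennreal \<bar>\<mu> B\<bar>) \<le> (\<Sum>B\<in>insert (A - \<Union>\<A>) \<A>. ennreal \<bar>\<mu> B\<bar>)"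
    using fin by (intro sum_mono2) auto
  ultimately show ?thesis by (metis order_trans)
qed

text \<open>Addition commutes with suprema in \<open>ennreal\<close> only over nonempty index sets.
  Removing \<open>{}\<close> covers the case \<open>A = {}\<close>, whose only partition has no
  blocks.\<close>

lemma partitions_nonempty:
  assumes "A \<in> sets M"
  shows "{\<A>. finite \<A> \<and> \<A> \<subseteq> sets M \<and> partition_on A \<A>} \<noteq> {}"
proof -
  have "{A} - {{}} \<in> {\<A>. finite \<A> \<and> \<A> \<subseteq> sets M \<and> partition_on A \<A>}"
    using assms by (auto simp: partition_on_def disjoint_def)
  then show ?thesis by blast
qed

text \<open>A partition of \<open>A\<close> and one of \<open>B\<close> together partition
  \<open>A \<union> B\<close>. They share no block, because blocks are nonempty, so the two sums add
  up.\<close>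

lemma total_variation_superadditive:
  assumes \<mu>: "\<mu> {} = 0" and A: "A \<in> sets M" and B: "B \<in> sets M" and AB: "A \<inter> B = {}"
  shows "total_variation M \<mu> A + total_variation M \<mu> B \<le> total_variation M \<mu> (A \<union> B)"
proof -
  let ?P = "\<lambda>A. {\<A>. finite \<A> \<and> \<A> \<subseteq> sets M \<and> partition_on A \<A>}"
  have *: "(\<Sum>B\<in>\<A>. ennreal \<bar>\<mu> B\<bar>) + (\<Sum>B\<in>\<B>. ennreal \<bar>\<mu> B\<bar>) \<le> total_variation M \<mu> (A \<union> B)"
    if "\<A> \<in> ?P A" "\<B> \<in> ?P B" for \<A> \<B>
  proof -
    have "\<A> \<inter> \<B> = {}"
    proof (rule ccontr)
      assume "\<A> \<inter> \<B> \<noteq> {}"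
      then obtain C where "C \<in> \<A>" "C \<in> \<B>" by blast
      then have "C \<subseteq> A" "C \<subseteq> B" "C \<noteq> {}" using that by (auto simp: partition_on_def)
      with AB show False by blast
    qed
    then have "(\<Sum>B\<in>\<A>. ennreal \<bar>\<mu> B\<bar>) + (\<Sum>B\<in>\<B>. ennreal \<bar>\<mu> B\<bar>) = (\<Sum>B\<in>\<A> \<union> \<B>. ennreal \<bar>\<mu> B\<bar>)"
      using that by (intro sum.union_disjoint[symmetric]) auto
    also have "\<dots> \<le> total_variation M \<mu> (A \<union> B)"
    proof (intro sum_le_total_variation)
      show "disjoint (\<A> \<union> \<B>)" "\<Union>(\<A> \<union> \<B>) \<subseteq> A \<union> B"
        using that AB by (auto simp: partition_on_def intro!: disjoint_union)
    qed (use that A B \<mu> in auto)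
    finally show ?thesis .
  qed
  have "total_variation M \<mu> A + (\<Sum>B\<in>\<B>. ennreal \<bar>\<mu> B\<bar>) \<le> total_variation M \<mu> (A \<union> B)" if "\<B> \<in> ?P B" for \<B>
    unfolding total_variation_def[of M \<mu> A]
    by (subst ennreal_SUP_add_left[symmetric, OF partitions_nonempty[OF A]])
       (intro SUP_least *[OF _ that])
  then show ?thesis
    unfolding total_variation_def[of M \<mu> B]
    by (subst ennreal_SUP_add_right[OF partitions_nonempty[OF B]]) (intro SUP_least)
qed

lemma total_variation_mono:
  assumes \<mu>: "\<mu> {} = 0" and "A \<in> sets M" "B \<in> sets M" and AB: "A \<subseteq> B"
  shows "total_variation M \<mu> A \<le> total_variation M \<mu> B"
proof -
  have "total_variation M \<mu> A \<le> total_variation M \<mu> A + total_variation M \<mu> (B - A)" by simp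
  also have "\<dots> \<le> total_variation M \<mu> (A \<union> (B - A))"
    using assms by (intro total_variation_superadditive) auto
  also have "A \<union> (B - A) = B" using AB by auto
  finally show ?thesis .
qed

text \<open>The right side may be infinite, as the real series need not converge absolutely; this is
  why the bound lives in \<open>ennreal\<close>.\<close>

lemma abs_sums_le_suminf:
  fixes x :: "nat \<Rightarrow> real"
  assumes "x sums s"
  shows "ennreal \<bar>s\<bar> \<le> (\<Sum>n. ennreal \<bar>x n\<bar>)"
proof (rule LIMSEQ_le_const2)
  show "(\<lambda>n. ennreal \<bar>\<Sum>i<n. x i\<bar>) \<longlonglongrightarrow> ennreal \<bar>s\<bar>"
    using assms unfolding sums_def by (intro tendsto_ennrealI tendsto_rabs)
  show "\<exists>N. \<forall>n\<ge>N. ennreal \<bar>\<Sum>i<n. x i\<bar> \<le> (\<Sum>n. ennreal \<bar>x n\<bar>)"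
  proof (intro exI allI impI)
    fix n
    have "ennreal \<bar>\<Sum>i<n. x i\<bar> \<le> ennreal (\<Sum>i<n. \<bar>x i\<bar>)" by (intro ennreal_leI sum_abs)
    also have "\<dots> = (\<Sum>i<n. ennreal \<bar>x i\<bar>)" by simp
    also have "\<dots> \<le> (\<Sum>n. ennreal \<bar>x n\<bar>)" by (rule sum_le_suminf) auto
    finally show "ennreal \<bar>\<Sum>i<n. x i\<bar> \<le> (\<Sum>n. ennreal \<bar>x n\<bar>)" .
  qed
qed

text \<open>Superadditivity over finite unions gives one inequality. For the other, each block of a
  partition of the union is cut along the sets \<open>A n\<close>, and the double sum is
  exchanged.\<close>

lemma countably_additive_total_variation:
  assumes \<mu>: "signed_additive M \<mu>"
  shows "countably_additive (sets M) (total_variation M \<mu>)"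
  unfolding countably_additive_def
proof (intro allI impI antisym)
  fix A :: "nat \<Rightarrow> 'a set"
  assume A: "range A \<subseteq> sets M" and disj: "disjoint_family A" and UN: "\<Union>(range A) \<in> sets M"
  note 0 = signed_additive_empty[OF \<mu>]
  have "(\<Sum>i<n. total_variation M \<mu> (A i)) \<le> total_variation M \<mu> (\<Union>i<n. A i)" for n
  proof (induction n)
    case (Suc n)
    have "(\<Sum>i<Suc n. total_variation M \<mu> (A i)) \<le> total_variation M \<mu> (\<Union>i<n. A i) + total_variation M \<mu> (A n)"
      using Suc by (simp add: add_mono)
    also have "\<dots> \<le> total_variation M \<mu> ((\<Union>i<n. A i) \<union> A n)"
    proof (intro total_variation_superadditive 0)
      have "A i \<inter> A n = {}" if "i < n" for i
        using disj that by (simp add: disjoint_family_on_def)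
      then show "(\<Union>i<n. A i) \<inter> A n = {}" by auto
    qed (use A in auto)
    also have "(\<Union>i<n. A i) \<union> A n = (\<Union>i<Suc n. A i)" by (auto simp: lessThan_Suc)
    finally show ?case .
  qed simp
  moreover have "total_variation M \<mu> (\<Union>i<n. A i) \<le> total_variation M \<mu> (\<Union>i. A i)" for n
    using A UN by (intro total_variation_mono 0) auto
  ultimately show "(\<Sum>i. total_variation M \<mu> (A i)) \<le> total_variation M \<mu> (\<Union>i. A i)"
    by (intro suminf_le_const) (auto intro: order_trans)
  show "total_variation M \<mu> (\<Union>i. A i) \<le> (\<Sum>i. total_variation M \<mu> (A i))"
    unfolding total_variation_def[of M \<mu> "\<Union>i. A i"]
  proof (rule SUP_least)
    fix \<B> assume "\<B> \<in> {\<A>. finite \<A> \<and> \<A> \<subseteq> sets M \<and> partition_on (\<Union>i. A i) \<A>}"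
    then have \<B>: "finite \<B>" "\<B> \<subseteq> sets M" "\<Union>\<B> = (\<Union>i. A i)" "disjoint \<B>"
      by (auto simp: partition_on_def)
    have "(\<lambda>n. \<mu> (B \<inter> A n)) sums \<mu> B" if "B \<in> \<B>" for B
    proof -
      have "(\<lambda>n. \<mu> (B \<inter> A n)) sums \<mu> (\<Union>n. B \<inter> A n)"
      proof (rule \<mu>[unfolded signed_additive_def, rule_format])
        show "range (\<lambda>n. B \<inter> A n) \<subseteq> sets M" using A \<B> that by auto
        show "disjoint_family (\<lambda>n. B \<inter> A n)" using disj by (auto simp: disjoint_family_on_def)
      qed
      moreover have "(\<Union>n. B \<inter> A n) = B" using \<B> that by blast
      ultimately show ?thesis by simp
    qed
    then have "(\<Sum>B\<in>\<B>. ennreal \<bar>\<mu> B\<bar>) \<le> (\<Sum>B\<in>\<B>. \<Sum>n. ennreal \<bar>\<mu> (B \<inter> A n)\<bar>)"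
      by (intro sum_mono abs_sums_le_suminf)
    also have "\<dots> = (\<Sum>n. \<Sum>B\<in>\<B>. ennreal \<bar>\<mu> (B \<inter> A n)\<bar>)"
      by (rule suminf_sum[symmetric]) auto
    also have "\<dots> \<le> (\<Sum>n. total_variation M \<mu> (A n))"
    proof (intro suminf_le allI)
      fix n
      \<comment> \<open>Distinct blocks can have the same trace on \<open>A n\<close> only if that
        trace is empty, and then the term vanishes; so the sum may be indexed by the traces.\<close>
      have "(\<Sum>B\<in>\<B>. ennreal \<bar>\<mu> (B \<inter> A n)\<bar>) = (\<Sum>C\<in>(\<lambda>B. B \<inter> A n) ` \<B>. ennreal \<bar>\<mu> C\<bar>)"
      proof (subst sum.reindex_nontrivial[OF \<open>finite \<B>\<close>])
        fix B B' assume "B \<in> \<B>" "B' \<in> \<B>" "B \<noteq> B'" and eq: "B \<inter> A n = B' \<inter> A n"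
        then have "B \<inter> B' = {}" using \<B>(4) by (auto simp: disjoint_def)
        then have "B \<inter> A n = {}" using eq by blast
        then show "ennreal \<bar>\<mu> (B \<inter> A n)\<bar> = 0" using 0 by simp
      qed simp
      also have "\<dots> \<le> total_variation M \<mu> (A n)"
      proof (intro sum_le_total_variation disjointI)
        fix C D assume "C \<in> (\<lambda>B. B \<inter> A n) ` \<B>" "D \<in> (\<lambda>B. B \<inter> A n) ` \<B>" "C \<noteq> D"
        then show "C \<inter> D = {}" using disjointD[OF \<B>(4)] by blast
      qed (use A \<B> 0 in auto)
      finally show "(\<Sum>B\<in>\<B>. ennreal \<bar>\<mu> (B \<inter> A n)\<bar>) \<le> total_variation M \<mu> (A n)" .
    qed auto
    finally show "(\<Sum>B\<in>\<B>. ennreal \<bar>\<mu> B\<bar>) \<le> (\<Sum>i. total_variation M \<mu> (A i))" .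
  qed
qed

lemma total_variation_nonneg:
  assumes \<mu>: "signed_additive M \<mu>" and pos: "\<And>B. B \<in> sets M \<Longrightarrow> 0 \<le> \<mu> B" and A: "A \<in> sets M"
  shows "total_variation M \<mu> A = ennreal (\<mu> A)"
proof (rule antisym)
  show "total_variation M \<mu> A \<le> ennreal (\<mu> A)"
    unfolding total_variation_def
  proof (rule SUP_least)
    fix \<A> assume "\<A> \<in> {\<A>. finite \<A> \<and> \<A> \<subseteq> sets M \<and> partition_on A \<A>}"
    then have \<A>: "finite \<A>" "\<A> \<subseteq> sets M" "\<Union>\<A> = A" "disjoint \<A>" by (auto simp: partition_on_def)
    have "(\<Sum>B\<in>\<A>. ennreal \<bar>\<mu> B\<bar>) = ennreal (\<Sum>B\<in>\<A>. \<bar>\<mu> B\<bar>)" by simp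
    also have "(\<Sum>B\<in>\<A>. \<bar>\<mu> B\<bar>) = (\<Sum>B\<in>\<A>. \<mu> B)" using \<A> pos by (intro sum.cong) auto
    also have "\<dots> = \<mu> A" using signed_additive_Union[OF \<mu>] \<A> by metis
    finally show "(\<Sum>B\<in>\<A>. ennreal \<bar>\<mu> B\<bar>) \<le> ennreal (\<mu> A)" by simp
  qed
  show "ennreal (\<mu> A) \<le> total_variation M \<mu> A"
    using sum_le_total_variation[of A M "{A}" \<mu>] A pos[OF A] signed_additive_empty[OF \<mu>] by simp
qed

lemma ca_signed_additive: "\<mu> \<in> ca M \<Longrightarrow> signed_additive M \<mu>"
  by (auto simp: ca_def signed_additive_def)

lemma sets_abs_measure [simp]: "sets (abs_measure M \<mu>) = sets M"
  and sets_pos_measure [simp]: "sets (pos_measure M \<mu>) = sets M"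
  and sets_neg_measure [simp]: "sets (neg_measure M \<mu>) = sets M"
  and space_abs_measure [simp]: "space (abs_measure M \<mu>) = space M"
  by (auto simp: abs_measure_def pos_measure_def neg_measure_def sets.space_closed sets.sigma_sets_eq)

lemma emeasure_abs_measure:
  assumes \<mu>: "signed_additive M \<mu>" and A: "A \<in> sets M"
  shows "emeasure (abs_measure M \<mu>) A = total_variation M \<mu> A"
proof (rule emeasure_measure_of[OF abs_measure_def])
  show "positive (sets (abs_measure M \<mu>)) (total_variation M \<mu>)"
    using signed_additive_empty[OF \<mu>]
    by (auto simp: positive_def total_variation_def partition_on_empty intro!: SUP_eqI)
qed (use countably_additive_total_variation[OF \<mu>] A in \<open>auto simp: sets.space_closed\<close>)

lemma finite_measure_abs_measure: "\<mu> \<in> ca M \<Longrightarrow> finite_measure (abs_measure M \<mu>)"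
  by (intro finite_measureI)
     (auto simp: emeasure_abs_measure ca_signed_additive, auto simp: ca_def)

text \<open>The two Jordan parts are half of the variation plus \<open>c * \<mu>\<close>, with
  \<open>c = 1\<close> and \<open>c = -1\<close>. The bound of \<open>\<bar>\<mu> A\<bar>\<close> by
  the variation makes these values nonnegative, so \<open>ennreal\<close> truncates nothing and
  countable additivity carries over from the real series.\<close>

lemma
  assumes \<mu>: "\<mu> \<in> ca M" and A: "A \<in> sets M"
  shows emeasure_pos_measure:
      "emeasure (pos_measure M \<mu>) A = ennreal ((enn2real (total_variation M \<mu> A) + \<mu> A) / 2)"
    and emeasure_neg_measure:
      "emeasure (neg_measure M \<mu>) A = ennreal ((enn2real (total_variation M \<mu> A) - \<mu> A) / 2)"
    and abs_le_total_variation: "\<bar>\<mu> A\<bar> \<le> enn2real (total_variation M \<mu> A)"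
proof -
  note add = ca_signed_additive[OF \<mu>]
  note 0 = signed_additive_empty[OF add]
  define T where "T B = enn2real (total_variation M \<mu> B)" for B
  have fin: "total_variation M \<mu> B < \<infinity>" if "B \<in> sets M" for B
    using total_variation_mono[where \<mu> = \<mu> and M = M and A = B and B = "space M", OF 0] that sets.sets_into_space[OF that] \<mu>
    by (auto simp: ca_def)
  have abs_le: "\<bar>\<mu> B\<bar> \<le> T B" if "B \<in> sets M" for B
  proof -
    have "ennreal \<bar>\<mu> B\<bar> \<le> total_variation M \<mu> B"
      using sum_le_total_variation[of B M "{B}" \<mu>] that 0 by simp
    then show ?thesis
      unfolding T_def using fin[OF that] by (metis abs_ge_zero enn2real_ennreal enn2real_mono infinity_ennreal_def)
  qed
  show "\<bar>\<mu> A\<bar> \<le> enn2real (total_variation M \<mu> A)" using abs_le[OF A] by (simp add: T_def)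
  have T0: "T {} = 0"
    using 0 by (auto simp: T_def total_variation_def partition_on_empty intro!: SUP_eqI)
  have sums_T: "(\<lambda>n. T (B n)) sums T (\<Union>n. B n)" if "range B \<subseteq> sets M" "disjoint_family B" for B :: "nat \<Rightarrow> 'a set"
  proof -
    have "(\<Sum>n. total_variation M \<mu> (B n)) = total_variation M \<mu> (\<Union>n. B n)"
      using countably_additive_total_variation[OF add] that by (auto simp: countably_additive_def)
    moreover have "total_variation M \<mu> C = ennreal (T C)" if "C \<in> sets M" for C
      using fin[OF that] by (simp add: T_def)
    ultimately have "(\<Sum>n. ennreal (T (B n))) = ennreal (T (\<Union>n. B n))"
      using that by (simp add: range_subsetD sets.countable_UN)
    moreover have "(\<lambda>n. ennreal (T (B n))) sums (\<Sum>n. ennreal (T (B n)))" by (rule summable_sums) auto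
    ultimately have "(\<lambda>n. ennreal (T (B n))) sums ennreal (T (\<Union>n. B n))" by simp
    then show ?thesis
      by (subst (asm) sums_ennreal) (auto simp: T_def)
  qed
  have sums_\<mu>: "(\<lambda>n. \<mu> (B n)) sums \<mu> (\<Union>n. B n)" if "range B \<subseteq> sets M" "disjoint_family B" for B :: "nat \<Rightarrow> 'a set"
    using that add by (auto simp: signed_additive_def)
  have main: "emeasure N A = ennreal ((T A + c * \<mu> A) / 2)"
    if N: "N = measure_of (space M) (sets M) (\<lambda>A. ennreal ((T A + c * \<mu> A) / 2))" and c: "\<bar>c\<bar> = 1" for N c
  proof (rule emeasure_measure_of[OF N])
    have [simp]: "sets N = sets M" by (simp add: N sets.space_closed sets.sigma_sets_eq)
    show "A \<in> sets N" using A by simp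
    show "positive (sets N) (\<lambda>A. ennreal ((T A + c * \<mu> A) / 2))" by (simp add: positive_def T0 0)
    show "countably_additive (sets N) (\<lambda>A. ennreal ((T A + c * \<mu> A) / 2))"
      unfolding countably_additive_def
    proof (intro allI impI)
      fix B :: "nat \<Rightarrow> 'a set" assume "range B \<subseteq> sets N" and d: "disjoint_family B"
      then have B: "range B \<subseteq> sets M" by simp
      have nn: "0 \<le> T C + c * \<mu> C" if "C \<in> sets M" for C
        using abs_le[OF that] c by (auto simp: abs_if split: if_splits)
      have "(\<lambda>n. (T (B n) + c * \<mu> (B n)) / 2) sums ((T (\<Union>n. B n) + c * \<mu> (\<Union>n. B n)) / 2)"
        using sums_T[OF B d] sums_\<mu>[OF B d] by (intro sums_divide sums_add sums_mult)
      moreover have "(\<Union>n. B n) \<in> sets M" using B by auto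
      ultimately have "(\<lambda>n. ennreal ((T (B n) + c * \<mu> (B n)) / 2)) sums ennreal ((T (\<Union>n. B n) + c * \<mu> (\<Union>n. B n)) / 2)"
        using B nn by (subst sums_ennreal) auto
      then show "(\<Sum>i. ennreal ((T (B i) + c * \<mu> (B i)) / 2)) = ennreal ((T (\<Union> (range B)) + c * \<mu> (\<Union> (range B))) / 2)"
        by (simp add: sums_iff)
    qed
  qed (simp add: sets.space_closed)
  show "emeasure (pos_measure M \<mu>) A = ennreal ((enn2real (total_variation M \<mu> A) + \<mu> A) / 2)"
    using main[of "pos_measure M \<mu>" 1] by (simp add: pos_measure_def T_def)
  show "emeasure (neg_measure M \<mu>) A = ennreal ((enn2real (total_variation M \<mu> A) - \<mu> A) / 2)"
    using main[of "neg_measure M \<mu>" "-1"] by (simp add: neg_measure_def T_def)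
qed

lemma
  assumes \<mu>: "\<mu> \<in> ca M" and A: "A \<in> sets M"
  shows emeasure_pos_le_abs: "emeasure (pos_measure M \<mu>) A \<le> emeasure (abs_measure M \<mu>) A"
    and emeasure_neg_le_abs: "emeasure (neg_measure M \<mu>) A \<le> emeasure (abs_measure M \<mu>) A"
proof -
  have "emeasure (abs_measure M \<mu>) A < \<infinity>"
    using finite_measure.emeasure_finite[OF finite_measure_abs_measure[OF \<mu>], of A] by (simp add: less_top)
  then have *: "emeasure (abs_measure M \<mu>) A = ennreal (enn2real (total_variation M \<mu> A))"
    by (simp add: emeasure_abs_measure[OF ca_signed_additive[OF \<mu>] A])
  show "emeasure (pos_measure M \<mu>) A \<le> emeasure (abs_measure M \<mu>) A"
    and "emeasure (neg_measure M \<mu>) A \<le> emeasure (abs_measure M \<mu>) A"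
    using abs_le_total_variation[OF \<mu> A]
    unfolding * emeasure_pos_measure[OF \<mu> A] emeasure_neg_measure[OF \<mu> A]
    by (auto intro!: ennreal_leI)
qed

text \<open>Meant for \<open>N\<close> a Jordan part and \<open>M\<close> the variation measure: the
  variation then controls integrals against a signed measure.\<close>

lemma integral_le_of_emeasure_le:
  fixes f :: "'a \<Rightarrow> real"
  assumes sets: "sets N = sets M" and le: "\<And>A. A \<in> sets M \<Longrightarrow> emeasure N A \<le> emeasure M A"
    and f: "integrable M f"
  shows "integrable N f" and "\<bar>integral\<^sup>L N f\<bar> \<le> (\<integral>\<omega>. \<bar>f \<omega>\<bar> \<partial>M)"
proof -
  have m: "f \<in> borel_measurable N" using f by (simp add: measurable_cong_sets[OF sets refl])
  have "N \<le> M" using le sets by (simp add: le_measure)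
  then have nn: "(\<integral>\<^sup>+\<omega>. ennreal \<bar>f \<omega>\<bar> \<partial>N) \<le> (\<integral>\<^sup>+\<omega>. ennreal \<bar>f \<omega>\<bar> \<partial>M)"
    by (intro nn_integral_mono_measure sets)
  also have "\<dots> < \<infinity>" using f by (auto simp: integrable_iff_bounded)
  finally show int: "integrable N f" using m by (auto simp: integrable_iff_bounded)
  have "ennreal (\<integral>\<omega>. \<bar>f \<omega>\<bar> \<partial>N) \<le> ennreal (\<integral>\<omega>. \<bar>f \<omega>\<bar> \<partial>M)"
    using nn int f by (simp add: nn_integral_eq_integral)
  then have "(\<integral>\<omega>. \<bar>f \<omega>\<bar> \<partial>N) \<le> (\<integral>\<omega>. \<bar>f \<omega>\<bar> \<partial>M)" by (subst (asm) ennreal_le_iff) auto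
  moreover have "\<bar>integral\<^sup>L N f\<bar> \<le> (\<integral>\<omega>. \<bar>f \<omega>\<bar> \<partial>N)" by (rule integral_abs_bound)
  ultimately show "\<bar>integral\<^sup>L N f\<bar> \<le> (\<integral>\<omega>. \<bar>f \<omega>\<bar> \<partial>M)" by (rule order_trans[rotated])
qed

lemma ca_plus_measures:
  assumes \<mu>: "\<mu> \<in> ca_plus M"
  shows "pos_measure M \<mu> = abs_measure M \<mu>" and "emeasure (neg_measure M \<mu>) (space M) = 0"
proof -
  have ca: "\<mu> \<in> ca M" and pos: "\<And>A. A \<in> sets M \<Longrightarrow> 0 \<le> \<mu> A"
    using \<mu> by (auto simp: ca_plus_def)
  have tv: "total_variation M \<mu> A = ennreal (\<mu> A)" if "A \<in> sets M" for A
    using total_variation_nonneg[OF ca_signed_additive[OF ca] _ that] pos by blast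
  show "pos_measure M \<mu> = abs_measure M \<mu>"
  proof (rule measure_eqI)
    fix A assume "A \<in> sets (pos_measure M \<mu>)"
    then have A: "A \<in> sets M" by simp
    show "emeasure (pos_measure M \<mu>) A = emeasure (abs_measure M \<mu>) A"
      using pos[OF A] tv[OF A] emeasure_pos_measure[OF ca A] emeasure_abs_measure[OF ca_signed_additive[OF ca] A]
      by simp
  qed simp
  show "emeasure (neg_measure M \<mu>) (space M) = 0"
    using tv[OF sets.top] pos[OF sets.top] emeasure_neg_measure[OF ca sets.top] by simp
qed

section \<open>Finite measures as elements of \<open>ca\<close>\<close>

lemma signed_additive_measure:
  assumes "finite_measure P" "sets P = sets M"
  shows "signed_additive M (measure P)"
  using finite_measure.finite_measure_UNION[OF assms(1)] assms(2) by (simp add: signed_additive_def)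

lemma total_variation_measure:
  assumes P: "finite_measure P" "sets P = sets M" and A: "A \<in> sets M"
  shows "total_variation M (measure P) A = emeasure P A"
  unfolding finite_measure.emeasure_eq_measure[OF P(1)]
  by (rule total_variation_nonneg[OF signed_additive_measure[OF P] measure_nonneg A])

lemma measure_in_ca_plus:
  assumes P: "finite_measure P" "sets P = sets M"
  shows "measure P \<in> ca_plus M"
proof -
  have "total_variation M (measure P) (space M) < \<infinity>"
    unfolding total_variation_measure[OF P sets.top]
    using finite_measure.emeasure_finite[OF P(1)] by (simp add: less_top)
  moreover have "measure P A = 0" if "A \<notin> sets M" for A
    using that P(2) by (simp add: measure_notin_sets)
  ultimately show ?thesis
    using signed_additive_measure[OF P] unfolding ca_plus_def ca_def signed_additive_def by (simp add: measure_nonneg)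
qed

lemma abs_measure_measure:
  assumes P: "finite_measure P" "sets P = sets M"
  shows "abs_measure M (measure P) = P"
proof (rule measure_eqI)
  fix A assume "A \<in> sets (abs_measure M (measure P))"
  then have A: "A \<in> sets M" by simp
  show "emeasure (abs_measure M (measure P)) A = emeasure P A"
    unfolding emeasure_abs_measure[OF signed_additive_measure[OF P] A] by (rule total_variation_measure[OF P A])
qed (simp add: P)

section \<open>Orlicz functions\<close>

lemma orlicz_function_mono: "orlicz_function \<phi> \<Longrightarrow> 0 \<le> x \<Longrightarrow> x \<le> y \<Longrightarrow> \<phi> x \<le> \<phi> y"
  by (auto simp: orlicz_function_def mono_on_def)

text \<open>The values of \<open>\<phi>\<close> on negative reals are arbitrary. Precomposing with
  \<open>max 0\<close> gives a monotone function on the whole line, whose superlevel sets are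
  intervals.\<close>

lemma orlicz_function_measurable:
  assumes \<phi>: "orlicz_function \<phi>"
  shows "(\<lambda>x. \<phi> \<bar>x\<bar>) \<in> borel_measurable borel"
proof -
  have "(\<lambda>x. \<phi> (max 0 x)) \<in> borel_measurable borel"
  proof (rule borel_measurableI_greater)
    fix y
    have "is_interval {x. y < \<phi> (max 0 x)}"
      unfolding is_interval_1
    proof safe
      fix a b x assume "y < \<phi> (max 0 a)" "a \<le> x"
      then show "y < \<phi> (max 0 x)"
        using orlicz_function_mono[OF \<phi>, of "max 0 a" "max 0 x"] by (auto intro: order_less_le_trans)
    qed
    then show "{x \<in> space borel. y < \<phi> (max 0 x)} \<in> sets borel"
      using real_interval_borel_measurable by simp
  qed
  then have "(\<lambda>x. \<phi> (max 0 \<bar>x\<bar>)) \<in> borel_measurable borel" by measurable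
  then show ?thesis by simp
qed

lemma orlicz_function_liminf:
  assumes \<phi>: "orlicz_function \<phi>" and x: "\<And>n. 0 \<le> x n" "x \<longlonglongrightarrow> l"
  shows "\<phi> l \<le> liminf (\<lambda>n. \<phi> (x n))"
proof -
  have l: "0 \<le> l" using x by (intro LIMSEQ_le_const) auto
  then have lsc: "\<phi> l \<le> Liminf (at l within {0..}) \<phi>" using \<phi> by (auto simp: orlicz_function_def)
  show ?thesis
    unfolding le_Liminf_iff
  proof (intro allI impI)
    fix y assume "y < \<phi> l"
    then have "eventually (\<lambda>z. y < \<phi> z) (at l within {0..})"
      using lsc by (auto simp: le_Liminf_iff)
    \<comment> \<open>The limit inferior ignores the point \<open>l\<close> itself, which the
      sequence may hit; there the inequality holds by the choice of \<open>y\<close>.\<close>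
    then have "eventually (\<lambda>z. z \<in> {0..} \<longrightarrow> y < \<phi> z) (nhds l)"
      unfolding eventually_at_filter by eventually_elim (use \<open>y < \<phi> l\<close> in auto)
    then have "eventually (\<lambda>n. x n \<in> {0..} \<longrightarrow> y < \<phi> (x n)) sequentially"
      using x(2) by (auto simp: filterlim_iff)
    then show "eventually (\<lambda>n. y < \<phi> (x n)) sequentially" using x(1) by simp
  qed
qed

lemma orlicz_function_convex:
  assumes \<phi>: "orlicz_function \<phi>" and "0 \<le> x" "0 \<le> y" "0 \<le> t" "t \<le> 1"
  shows "\<phi> ((1 - t) * x + t * y) \<le> ennreal (1 - t) * \<phi> x + ennreal t * \<phi> y"
  using assms by (auto simp: orlicz_function_def)

text \<open>Convexity and \<open>\<phi> 0 = 0\<close> give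
  \<open>\<phi> x1 \<le> (x1 / x) * \<phi> x\<close> beyond \<open>x1\<close>, hence linear growth;
  up to \<open>x1\<close> the summand 1 suffices.\<close>

lemma orlicz_function_linear_bound:
  assumes \<phi>: "orlicz_function \<phi>"
  obtains a where "0 < a" "\<And>x. 0 \<le> x \<Longrightarrow> ennreal x \<le> ennreal a * (1 + \<phi> x)"
proof -
  obtain x1 where x1: "0 < x1" "0 < \<phi> x1" using \<phi> by (auto simp: orlicz_function_def)
  \<comment> \<open>Capping at 1 keeps \<open>b\<close> finite if
    \<open>\<phi> x1 = \<infinity>\<close>, and \<open>b \<le> 1\<close> makes \<open>x1 / b\<close>
    at least \<open>x1\<close>, as the range \<open>x \<le> x1\<close> demands.\<close>
  define b where "b = enn2real (min 1 (\<phi> x1))"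
  have b_eq: "ennreal b = min 1 (\<phi> x1)"
    by (auto simp: b_def min_less_iff_disj intro!: ennreal_enn2real)
  have b: "0 < b" using x1 b_eq by (metis ennreal_less_zero_iff ennreal_zero_less_one min_less_iff_conj)
  have "b \<le> 1" using b_eq b by (metis ennreal_1 ennreal_le_iff min.cobounded1 zero_le_one)
  show ?thesis
  proof (rule that)
    show "0 < x1 / b" using x1 b by simp
    fix x :: real assume x: "0 \<le> x"
    show "ennreal x \<le> ennreal (x1 / b) * (1 + \<phi> x)"
    proof (cases "x \<le> x1")
      case True
      have "x * b \<le> x1 * 1" using True x b \<open>b \<le> 1\<close> by (intro mult_mono) auto
      then have "x \<le> x1 / b" using b by (simp add: field_simps)
      then have "ennreal x \<le> ennreal (x1 / b) * 1" by (simp add: ennreal_leI)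
      also have "\<dots> \<le> ennreal (x1 / b) * (1 + \<phi> x)" by (intro mult_left_mono) auto
      finally show ?thesis .
    next
      case False
      then have x: "0 < x" "x1 \<le> x" using x1 by auto
      have "\<phi> ((1 - x1 / x) * 0 + x1 / x * x) \<le> ennreal (1 - x1 / x) * \<phi> 0 + ennreal (x1 / x) * \<phi> x"
        using x x1 by (intro orlicz_function_convex[OF \<phi>]) (auto simp: field_simps)
      then have "\<phi> x1 \<le> ennreal (x1 / x) * \<phi> x" using x \<phi> by (simp add: orlicz_function_def)
      moreover have "ennreal b \<le> \<phi> x1" using b_eq by simp
      ultimately have "ennreal b \<le> ennreal (x1 / x) * \<phi> x" by (metis order_trans)
      then have "ennreal (x / b) * ennreal b \<le> ennreal (x / b) * (ennreal (x1 / x) * \<phi> x)"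
        by (intro mult_left_mono) auto
      then have "ennreal x \<le> ennreal (x1 / b) * \<phi> x"
        using x b x1 by (simp add: mult.assoc[symmetric] ennreal_mult[symmetric])
      also have "\<dots> \<le> ennreal (x1 / b) * (1 + \<phi> x)" by (intro mult_left_mono) auto
      finally show ?thesis .
    qed
  qed
qed

section \<open>Robust Orlicz spaces in terms of random variables\<close>

text \<open>With a filter, statements valid almost surely under every \<open>P\<close> can be
  combined by \<open>eventually_elim\<close> for all \<open>P\<close> at once.\<close>

definition quasi_surely :: "'a measure set \<Rightarrow> 'a filter" where
  "quasi_surely \<PP> = (SUP P\<in>\<PP>. ae_filter P)"

lemma eventually_quasi_surely: "eventually Q (quasi_surely \<PP>) \<longleftrightarrow> (\<forall>P\<in>\<PP>. AE \<omega> in P. Q \<omega>)"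
  by (simp add: quasi_surely_def eventually_Sup)

text \<open>\<PP> may be uncountable; the countable quantifier can be moved because it can be moved
  under each single \<open>P\<close>.\<close>

lemma eventually_quasi_surely_all:
  "(\<forall>\<^sub>F \<omega> in quasi_surely \<PP>. \<forall>n::nat. Q n \<omega>) \<longleftrightarrow> (\<forall>n. \<forall>\<^sub>F \<omega> in quasi_surely \<PP>. Q n \<omega>)"
  by (auto simp: eventually_quasi_surely AE_all_countable)

text \<open>The balls of the Luxemburg norm, as sets of random variables: all norm estimates below are
  statements about them.\<close>

definition lux_ball ::
  "'a measure set \<Rightarrow> ('a measure \<Rightarrow> real \<Rightarrow> ennreal) \<Rightarrow> real \<Rightarrow> ('a \<Rightarrow> real) \<Rightarrow> bool" where
  "lux_ball \<PP> \<Phi> l f \<longleftrightarrow> 0 < l \<and> (\<forall>P\<in>\<PP>. (\<integral>\<^sup>+\<omega>. \<Phi> P (inverse l * \<bar>f \<omega>\<bar>) \<partial>P) \<le> 1)"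

text \<open>Spaces of classes are handled through their random variables, so that vector and lattice
  operations become pointwise and the choice made by \<open>rep\<close> disappears. By
  \<open>fn_cong\<close> the set is saturated under quasi-sure equality.\<close>

definition fn :: "'a measure \<Rightarrow> 'a measure set \<Rightarrow> ('a \<Rightarrow> real) set set \<Rightarrow> ('a \<Rightarrow> real) set" where
  "fn M \<PP> \<A> = {f \<in> borel_measurable M. qs_class M \<PP> f \<in> \<A>}"

locale robust_orlicz =
  fixes M :: "'a measure" and \<PP> :: "'a measure set" and \<Phi> :: "'a measure \<Rightarrow> real \<Rightarrow> ennreal"
  assumes nonempty: "\<PP> \<noteq> {}"
    and prob: "\<And>P. P \<in> \<PP> \<Longrightarrow> prob_space P \<and> sets P = sets M"
    and orlicz: "\<And>P. P \<in> \<PP> \<Longrightarrow> orlicz_function (\<Phi> P)"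
begin

abbreviation "qs \<equiv> quasi_surely \<PP>"
abbreviation "cls \<equiv> qs_class M \<PP>"
abbreviation "lball \<equiv> lux_ball \<PP> \<Phi>"

lemma measurable_P: "P \<in> \<PP> \<Longrightarrow> f \<in> borel_measurable M \<Longrightarrow> f \<in> borel_measurable P"
  using prob measurable_cong_sets[of P M borel borel] by auto

lemma space_P: "P \<in> \<PP> \<Longrightarrow> space P = space M"
  using prob sets_eq_imp_space_eq by blast

lemma eventually_qs_space: "\<forall>\<^sub>F \<omega> in qs. \<omega> \<in> space M"
  using AE_space space_P by (fastforce simp: eventually_quasi_surely)

lemma qs_rel_iff:
  "(f, g) \<in> qs_rel M \<PP> \<longleftrightarrow> f \<in> borel_measurable M \<and> g \<in> borel_measurable M \<and> (\<forall>\<^sub>F \<omega> in qs. f \<omega> = g \<omega>)"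
  by (simp add: qs_rel_def eventually_quasi_surely)

lemma equiv_qs_rel: "equiv (borel_measurable M) (qs_rel M \<PP>)"
proof (rule equivI)
  show "qs_rel M \<PP> \<subseteq> borel_measurable M \<times> borel_measurable M" by (auto simp: qs_rel_def)
  show "refl_on (borel_measurable M) (qs_rel M \<PP>)" by (auto simp: qs_rel_def refl_on_def)
  show "sym (qs_rel M \<PP>)" by (auto simp: qs_rel_def sym_def eq_commute)
  show "trans (qs_rel M \<PP>)"
  proof (rule transI)
    fix f g h assume *: "(f, g) \<in> qs_rel M \<PP>" "(g, h) \<in> qs_rel M \<PP>"
    then have "\<forall>\<^sub>F \<omega> in qs. f \<omega> = g \<omega>" "\<forall>\<^sub>F \<omega> in qs. g \<omega> = h \<omega>" by (auto simp: qs_rel_iff)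
    then have "\<forall>\<^sub>F \<omega> in qs. f \<omega> = h \<omega>" by eventually_elim simp
    with * show "(f, h) \<in> qs_rel M \<PP>" by (simp add: qs_rel_iff)
  qed
qed

lemma cls_eq_iff:
  assumes "f \<in> borel_measurable M" "g \<in> borel_measurable M"
  shows "cls f = cls g \<longleftrightarrow> (\<forall>\<^sub>F \<omega> in qs. f \<omega> = g \<omega>)"
  unfolding qs_class_def using assms eq_equiv_class_iff[OF equiv_qs_rel] by (auto simp: qs_rel_iff)

lemma cls_in_L0 [simp]: "f \<in> borel_measurable M \<Longrightarrow> cls f \<in> L0 M \<PP>"
  unfolding qs_class_def L0_def by (rule quotientI)

lemma rep_cls:
  assumes "f \<in> borel_measurable M"
  shows "rep (cls f) \<in> borel_measurable M" and "\<forall>\<^sub>F \<omega> in qs. rep (cls f) \<omega> = f \<omega>"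
proof -
  have "f \<in> cls f" using assms by (simp add: qs_class_def qs_rel_iff)
  then have "rep (cls f) \<in> cls f" unfolding rep_def by (rule someI[of "\<lambda>g. g \<in> cls f"])
  then have *: "(f, rep (cls f)) \<in> qs_rel M \<PP>" by (simp add: qs_class_def)
  then show "rep (cls f) \<in> borel_measurable M" by (simp add: qs_rel_iff)
  have "\<forall>\<^sub>F \<omega> in qs. f \<omega> = rep (cls f) \<omega>" using * by (simp add: qs_rel_iff)
  then show "\<forall>\<^sub>F \<omega> in qs. rep (cls f) \<omega> = f \<omega>" by eventually_elim simp
qed

lemma L0_rep:
  assumes "X \<in> L0 M \<PP>"
  shows "rep X \<in> borel_measurable M" and "cls (rep X) = X"
proof -
  obtain f where f: "f \<in> borel_measurable M" "X = cls f"
    using assms by (auto simp: L0_def quotient_def qs_class_def)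
  show "rep X \<in> borel_measurable M" using rep_cls f by simp
  then show "cls (rep X) = X" using rep_cls[OF f(1)] f by (simp add: cls_eq_iff)
qed

lemma fn_cong:
  assumes "f \<in> fn M \<PP> \<A>" "g \<in> borel_measurable M" "\<forall>\<^sub>F \<omega> in qs. f \<omega> = g \<omega>"
  shows "g \<in> fn M \<PP> \<A>"
  using assms cls_eq_iff[of f g] by (auto simp: fn_def)

lemma
  assumes f: "f \<in> borel_measurable M" and g: "g \<in> borel_measurable M"
  shows qs_add_cls: "qs_add M \<PP> (cls f) (cls g) = cls (\<lambda>\<omega>. f \<omega> + g \<omega>)"
    and qs_diff_cls: "qs_diff M \<PP> (cls f) (cls g) = cls (\<lambda>\<omega>. f \<omega> - g \<omega>)"
    and qs_scale_cls: "qs_scale M \<PP> c (cls f) = cls (\<lambda>\<omega>. c * f \<omega>)"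
    and qs_sup_cls: "qs_sup M \<PP> (cls f) (cls g) = cls (\<lambda>\<omega>. max (f \<omega>) (g \<omega>))"
    and qs_abs_cls: "qs_abs M \<PP> (cls f) = cls (\<lambda>\<omega>. \<bar>f \<omega>\<bar>)"
proof -
  note [measurable] = rep_cls(1)[OF f] rep_cls(1)[OF g] f g
  note ev = rep_cls(2)[OF f] rep_cls(2)[OF g]
  show "qs_add M \<PP> (cls f) (cls g) = cls (\<lambda>\<omega>. f \<omega> + g \<omega>)"
    unfolding qs_add_def by (subst cls_eq_iff, simp_all) (use ev in eventually_elim, simp)
  show "qs_diff M \<PP> (cls f) (cls g) = cls (\<lambda>\<omega>. f \<omega> - g \<omega>)"
    unfolding qs_diff_def by (subst cls_eq_iff, simp_all) (use ev in eventually_elim, simp)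
  show "qs_scale M \<PP> c (cls f) = cls (\<lambda>\<omega>. c * f \<omega>)"
    unfolding qs_scale_def by (subst cls_eq_iff, measurable) (use ev in eventually_elim, simp)
  show "qs_sup M \<PP> (cls f) (cls g) = cls (\<lambda>\<omega>. max (f \<omega>) (g \<omega>))"
    unfolding qs_sup_def by (subst cls_eq_iff, simp_all) (use ev in eventually_elim, simp)
  show "qs_abs M \<PP> (cls f) = cls (\<lambda>\<omega>. \<bar>f \<omega>\<bar>)"
    unfolding qs_abs_def by (subst cls_eq_iff, simp_all) (use ev in eventually_elim, simp)
qed

lemma qs_le_cls:
  assumes f: "f \<in> borel_measurable M" and g: "g \<in> borel_measurable M"
  shows "qs_le \<PP> (cls f) (cls g) \<longleftrightarrow> (\<forall>\<^sub>F \<omega> in qs. f \<omega> \<le> g \<omega>)"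
proof
  assume "qs_le \<PP> (cls f) (cls g)"
  moreover have "f \<in> cls f" "g \<in> cls g" using f g by (auto simp: qs_class_def qs_rel_iff)
  ultimately show "\<forall>\<^sub>F \<omega> in qs. f \<omega> \<le> g \<omega>" by (auto simp: qs_le_def eventually_quasi_surely)
next
  assume le: "\<forall>\<^sub>F \<omega> in qs. f \<omega> \<le> g \<omega>"
  have "\<forall>\<^sub>F \<omega> in qs. f' \<omega> \<le> g' \<omega>" if "f' \<in> cls f" "g' \<in> cls g" for f' g'
  proof -
    have "\<forall>\<^sub>F \<omega> in qs. f \<omega> = f' \<omega>" "\<forall>\<^sub>F \<omega> in qs. g \<omega> = g' \<omega>"
      using that by (auto simp: qs_class_def qs_rel_iff)
    with le show ?thesis by eventually_elim simp
  qed
  then show "qs_le \<PP> (cls f) (cls g)" by (auto simp: qs_le_def eventually_quasi_surely)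
qed

section \<open>Estimates for the balls of the Luxemburg norm\<close>

lemma lball_mono:
  assumes "lball l g" "\<forall>\<^sub>F \<omega> in qs. \<bar>f \<omega>\<bar> \<le> \<bar>g \<omega>\<bar>" "l \<le> m"
  shows "lball m f"
  unfolding lux_ball_def
proof (intro conjI ballI)
  have l: "0 < l" using assms by (simp add: lux_ball_def)
  then show "0 < m" using assms by simp
  fix P assume P: "P \<in> \<PP>"
  have "AE \<omega> in P. \<bar>f \<omega>\<bar> \<le> \<bar>g \<omega>\<bar>" using assms P by (auto simp: eventually_quasi_surely)
  then have "(\<integral>\<^sup>+\<omega>. \<Phi> P (inverse m * \<bar>f \<omega>\<bar>) \<partial>P) \<le> (\<integral>\<^sup>+\<omega>. \<Phi> P (inverse l * \<bar>g \<omega>\<bar>) \<partial>P)"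
  proof (intro nn_integral_mono_AE, eventually_elim)
    fix \<omega> assume "\<bar>f \<omega>\<bar> \<le> \<bar>g \<omega>\<bar>"
    then have "inverse m * \<bar>f \<omega>\<bar> \<le> inverse l * \<bar>g \<omega>\<bar>"
      using l assms(3) by (intro mult_mono) (auto simp: le_imp_inverse_le)
    then show "\<Phi> P (inverse m * \<bar>f \<omega>\<bar>) \<le> \<Phi> P (inverse l * \<bar>g \<omega>\<bar>)"
      using l assms(3) by (intro orlicz_function_mono orlicz P) auto
  qed
  also have "\<dots> \<le> 1" using assms P by (auto simp: lux_ball_def)
  finally show "(\<integral>\<^sup>+\<omega>. \<Phi> P (inverse m * \<bar>f \<omega>\<bar>) \<partial>P) \<le> 1" .
qed

lemma lball_pos: "lball l f \<Longrightarrow> 0 < l"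
  by (simp add: lux_ball_def)

lemma lball_zero: "0 < l \<Longrightarrow> lball l (\<lambda>_. 0)"
  using orlicz by (auto simp: lux_ball_def orlicz_function_def)

lemma lball_scale:
  assumes "lball l f" "c \<noteq> 0"
  shows "lball (\<bar>c\<bar> * l) (\<lambda>\<omega>. c * f \<omega>)"
proof -
  have "inverse (\<bar>c\<bar> * l) * \<bar>c * f \<omega>\<bar> = inverse l * \<bar>f \<omega>\<bar>" for \<omega>
    using assms(2) by (simp add: abs_mult)
  then show ?thesis using assms unfolding lux_ball_def by (simp only: zero_less_mult_iff zero_less_abs_iff) simp
qed

lemma measurable_Phi:
  assumes P: "P \<in> \<PP>" and f: "f \<in> borel_measurable M" and l: "0 < l"
  shows "(\<lambda>\<omega>. \<Phi> P (inverse l * \<bar>f \<omega>\<bar>)) \<in> borel_measurable P"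
proof -
  note measurable_P[OF P f, measurable] orlicz_function_measurable[OF orlicz[OF P], measurable]
  have "(\<lambda>\<omega>. \<Phi> P \<bar>inverse l * f \<omega>\<bar>) \<in> borel_measurable P" by measurable
  then show ?thesis using l by (simp add: abs_mult)
qed

lemma lball_add:
  assumes f: "f \<in> borel_measurable M" and g: "g \<in> borel_measurable M" and "lball l f" "lball m g"
  shows "lball (l + m) (\<lambda>\<omega>. f \<omega> + g \<omega>)"
  unfolding lux_ball_def
proof (intro conjI ballI)
  have lm: "0 < l" "0 < m" using assms by (auto simp: lux_ball_def)
  then show "0 < l + m" by simp
  \<comment> \<open>With this weight \<open>(f + g) / (l + m)\<close> is a convex combination of
    \<open>f / l\<close> and \<open>g / m\<close>, as in the usual proof of the triangle
    inequality.\<close>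
  define t where "t = m / (l + m)"
  have t: "0 \<le> t" "t \<le> 1" and tm: "t * inverse m = inverse (l + m)" "(1 - t) * inverse l = inverse (l + m)"
    using lm by (auto simp: t_def divide_simps)
  fix P assume P: "P \<in> \<PP>"
  note measurable_Phi[OF P f lm(1), measurable] measurable_Phi[OF P g lm(2), measurable]
  have "(\<integral>\<^sup>+\<omega>. \<Phi> P (inverse (l + m) * \<bar>f \<omega> + g \<omega>\<bar>) \<partial>P)
    \<le> (\<integral>\<^sup>+\<omega>. ennreal (1 - t) * \<Phi> P (inverse l * \<bar>f \<omega>\<bar>) + ennreal t * \<Phi> P (inverse m * \<bar>g \<omega>\<bar>) \<partial>P)"
  proof (intro nn_integral_mono)
    fix \<omega>
    have "inverse (l + m) * \<bar>f \<omega> + g \<omega>\<bar> \<le> inverse (l + m) * (\<bar>f \<omega>\<bar> + \<bar>g \<omega>\<bar>)"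
      using lm by (intro mult_left_mono) auto
    also have "\<dots> = (1 - t) * inverse l * \<bar>f \<omega>\<bar> + t * inverse m * \<bar>g \<omega>\<bar>"
      unfolding tm by (simp add: algebra_simps)
    finally have "\<Phi> P (inverse (l + m) * \<bar>f \<omega> + g \<omega>\<bar>)
      \<le> \<Phi> P ((1 - t) * (inverse l * \<bar>f \<omega>\<bar>) + t * (inverse m * \<bar>g \<omega>\<bar>))"
      using lm by (intro orlicz_function_mono orlicz P) (auto simp: mult.assoc)
    also have "\<dots> \<le> ennreal (1 - t) * \<Phi> P (inverse l * \<bar>f \<omega>\<bar>) + ennreal t * \<Phi> P (inverse m * \<bar>g \<omega>\<bar>)"
      using lm t by (intro orlicz_function_convex orlicz P) auto
    finally show "\<Phi> P (inverse (l + m) * \<bar>f \<omega> + g \<omega>\<bar>)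
      \<le> ennreal (1 - t) * \<Phi> P (inverse l * \<bar>f \<omega>\<bar>) + ennreal t * \<Phi> P (inverse m * \<bar>g \<omega>\<bar>)" .
  qed
  also have "\<dots> = ennreal (1 - t) * (\<integral>\<^sup>+\<omega>. \<Phi> P (inverse l * \<bar>f \<omega>\<bar>) \<partial>P)
      + ennreal t * (\<integral>\<^sup>+\<omega>. \<Phi> P (inverse m * \<bar>g \<omega>\<bar>) \<partial>P)"
    by (simp add: nn_integral_add nn_integral_cmult)
  also have "\<dots> \<le> ennreal (1 - t) * 1 + ennreal t * 1"
    using assms P by (intro add_mono mult_left_mono) (auto simp: lux_ball_def)
  also have "\<dots> = 1" using t by (simp flip: ennreal_plus)
  finally show "(\<integral>\<^sup>+\<omega>. \<Phi> P (inverse (l + m) * \<bar>f \<omega> + g \<omega>\<bar>) \<partial>P) \<le> 1" .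
qed

text \<open>Lower semicontinuity of the Orlicz functions and Fatou's lemma under each
  \<open>P\<close> keep the radius unchanged in the limit. Completeness of closed sublattices rests
  on this.\<close>

lemma lball_Fatou:
  assumes f: "\<And>n. f n \<in> borel_measurable M" and b: "\<And>n. lball l (f n)"
    and lim: "\<forall>\<^sub>F \<omega> in qs. (\<lambda>n. f n \<omega>) \<longlonglongrightarrow> g \<omega>"
  shows "lball l g"
  unfolding lux_ball_def
proof (intro conjI ballI)
  show l: "0 < l" using b by (auto simp: lux_ball_def)
  fix P assume P: "P \<in> \<PP>"
  have "AE \<omega> in P. (\<lambda>n. f n \<omega>) \<longlonglongrightarrow> g \<omega>" using lim P by (auto simp: eventually_quasi_surely)
  then have "(\<integral>\<^sup>+\<omega>. \<Phi> P (inverse l * \<bar>g \<omega>\<bar>) \<partial>P) \<le> (\<integral>\<^sup>+\<omega>. liminf (\<lambda>n. \<Phi> P (inverse l * \<bar>f n \<omega>\<bar>)) \<partial>P)"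
  proof (intro nn_integral_mono_AE, eventually_elim)
    fix \<omega> assume "(\<lambda>n. f n \<omega>) \<longlonglongrightarrow> g \<omega>"
    then show "\<Phi> P (inverse l * \<bar>g \<omega>\<bar>) \<le> liminf (\<lambda>n. \<Phi> P (inverse l * \<bar>f n \<omega>\<bar>))"
      using l by (intro orlicz_function_liminf orlicz P tendsto_intros) auto
  qed
  also have "\<dots> \<le> liminf (\<lambda>n. \<integral>\<^sup>+\<omega>. \<Phi> P (inverse l * \<bar>f n \<omega>\<bar>) \<partial>P)"
    by (intro nn_integral_liminf measurable_Phi P f l)
  also have "\<dots> \<le> liminf (\<lambda>n. 1)"
    using b P by (intro Liminf_mono always_eventually) (auto simp: lux_ball_def)
  also have "\<dots> = 1" by (simp add: Liminf_const)
  finally show "(\<integral>\<^sup>+\<omega>. \<Phi> P (inverse l * \<bar>g \<omega>\<bar>) \<partial>P) \<le> 1" .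
qed

text \<open>A continuous embedding of \<open>LPhi\<close> into the \<open>P\<close>-integrable
  functions, with \<open>K\<close> depending on \<open>P\<close>. Inserting
  \<open>\<bar>f\<bar> / l\<close> into the linear bound and integrating gives at most
  \<open>a * l * (1 + 1)\<close>, whence the factor 2.\<close>

lemma lball_nn_integral_bound:
  assumes P: "P \<in> \<PP>"
  obtains K where "0 < K"
    "\<And>f l. f \<in> borel_measurable M \<Longrightarrow> lball l f \<Longrightarrow> (\<integral>\<^sup>+\<omega>. ennreal \<bar>f \<omega>\<bar> \<partial>P) \<le> ennreal (K * l)"
proof -
  interpret prob_space P using prob P by simp
  obtain a where a: "0 < a" "\<And>x. 0 \<le> x \<Longrightarrow> ennreal x \<le> ennreal a * (1 + \<Phi> P x)"
    using orlicz_function_linear_bound[OF orlicz[OF P]] by blast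
  show ?thesis
  proof (rule that)
    show "0 < a * 2" using a by simp
    fix f l assume f: "f \<in> borel_measurable M" and b: "lball l f"
    have l: "0 < l" using lball_pos[OF b] .
    note [measurable] = measurable_Phi[OF P f l]
    have "(\<integral>\<^sup>+\<omega>. ennreal \<bar>f \<omega>\<bar> \<partial>P) \<le> (\<integral>\<^sup>+\<omega>. ennreal (a * l) * (1 + \<Phi> P (inverse l * \<bar>f \<omega>\<bar>)) \<partial>P)"
    proof (intro nn_integral_mono)
      fix \<omega>
      have "ennreal l * ennreal (inverse l * \<bar>f \<omega>\<bar>) \<le> ennreal l * (ennreal a * (1 + \<Phi> P (inverse l * \<bar>f \<omega>\<bar>)))"
        using l by (intro mult_left_mono a) auto
      then show "ennreal \<bar>f \<omega>\<bar> \<le> ennreal (a * l) * (1 + \<Phi> P (inverse l * \<bar>f \<omega>\<bar>))"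
        using l a(1) by (simp add: ennreal_mult[symmetric] mult.assoc[symmetric] mult.commute)
    qed
    also have "\<dots> = ennreal (a * l) * (1 + (\<integral>\<^sup>+\<omega>. \<Phi> P (inverse l * \<bar>f \<omega>\<bar>) \<partial>P))"
      by (simp add: nn_integral_cmult nn_integral_add emeasure_space_1)
    also have "\<dots> \<le> ennreal (a * l) * (1 + 1)"
      using b P by (intro mult_left_mono add_left_mono) (auto simp: lux_ball_def)
    also have "\<dots> = ennreal (a * 2 * l)"
      using a l by (simp add: ennreal_mult mult.commute mult.left_commute)
    finally show "(\<integral>\<^sup>+\<omega>. ennreal \<bar>f \<omega>\<bar> \<partial>P) \<le> ennreal (a * 2 * l)" .
  qed
qed

text \<open>An infimum lies below \<epsilon> exactly if some admissible radius does, so strict norm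
  bounds turn into statements about \<open>lball\<close> and the infimum is never evaluated.\<close>

lemma lux_norm_less_iff:
  assumes f: "f \<in> borel_measurable M"
  shows "lux_norm \<PP> \<Phi> (cls f) < ennreal \<epsilon> \<longleftrightarrow> (\<exists>l<\<epsilon>. lball l f)"
    and "lux_norm \<PP> \<Phi> (cls f) < \<infinity> \<longleftrightarrow> (\<exists>l. lball l f)"
proof -
  note r = rep_cls[OF f]
  have "lball l (rep (cls f)) \<longleftrightarrow> lball l f" for l
  proof
    have le: "\<forall>\<^sub>F \<omega> in qs. \<bar>rep (cls f) \<omega>\<bar> \<le> \<bar>f \<omega>\<bar>" "\<forall>\<^sub>F \<omega> in qs. \<bar>f \<omega>\<bar> \<le> \<bar>rep (cls f) \<omega>\<bar>"
      using r(2) by (auto elim!: eventually_mono)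
    show "lball l f" if "lball l (rep (cls f))" using lball_mono[OF that le(2)] by simp
    show "lball l (rep (cls f))" if "lball l f" using lball_mono[OF that le(1)] by simp
  qed
  then have eq: "lux_norm \<PP> \<Phi> (cls f) = Inf {ennreal l |l. lball l f}"
    unfolding lux_norm_def lux_ball_def[symmetric] by (simp add: lux_ball_def SUP_le_iff)
  show "lux_norm \<PP> \<Phi> (cls f) < ennreal \<epsilon> \<longleftrightarrow> (\<exists>l<\<epsilon>. lball l f)"
    unfolding eq Inf_less_iff using lball_pos by (fastforce simp: ennreal_less_iff)
  show "lux_norm \<PP> \<Phi> (cls f) < \<infinity> \<longleftrightarrow> (\<exists>l. lball l f)"
    unfolding eq Inf_less_iff by auto
qed

lemma fn_LPhi: "fn M \<PP> (LPhi M \<PP> \<Phi>) = {f \<in> borel_measurable M. \<exists>l. lball l f}"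
  using lux_norm_less_iff(2) by (auto simp: fn_def LPhi_def)

end

section \<open>Measures dominated by \<open>\<PP>\<close>\<close>

text \<open>Absolute continuity with respect to the polar sets, stated for a measure instead of a
  set function so that \<open>AE\<close> and Bochner integrals are at hand.\<close>

definition qs_continuous :: "'a measure \<Rightarrow> 'a measure set \<Rightarrow> 'a measure \<Rightarrow> bool" where
  "qs_continuous M \<PP> N \<longleftrightarrow> sets N = sets M \<and>
     (\<forall>A\<in>sets M. (\<forall>P\<in>\<PP>. emeasure P A = 0) \<longrightarrow> emeasure N A = 0)"

context robust_orlicz
begin

lemma emeasure_eq_0_iff_qs:
  assumes "A \<in> sets M"
  shows "(\<forall>P\<in>\<PP>. emeasure P A = 0) \<longleftrightarrow> (\<forall>\<^sub>F \<omega> in qs. \<omega> \<notin> A)"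
proof -
  have "emeasure P A = 0 \<longleftrightarrow> (AE \<omega> in P. \<omega> \<notin> A)" if "P \<in> \<PP>" for P
    using AE_iff_null_sets[of A P] prob[OF that] assms by auto
  then show ?thesis by (simp add: eventually_quasi_surely)
qed

text \<open>Each \<open>P\<close> may come with its own exceptional set. Measurability of
  \<open>Q\<close> makes the set where \<open>Q\<close> fails one measurable set that is null for
  every \<open>P\<close>, and to it \<open>qs_continuous\<close> applies.\<close>

lemma AE_qs_continuous:
  assumes N: "qs_continuous M \<PP> N" and Q: "Measurable.pred M Q" and ev: "\<forall>\<^sub>F \<omega> in qs. Q \<omega>"
  shows "AE \<omega> in N. Q \<omega>"
proof -
  define A where "A = {\<omega> \<in> space M. \<not> Q \<omega>}"
  have A: "A \<in> sets M" unfolding A_def using Q by measurable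
  have "\<forall>\<^sub>F \<omega> in qs. \<omega> \<notin> A" using ev by eventually_elim (simp add: A_def)
  then have "emeasure N A = 0"
    using N A emeasure_eq_0_iff_qs[OF A] by (auto simp: qs_continuous_def)
  moreover have "space N = space M" using N sets_eq_imp_space_eq by (auto simp: qs_continuous_def)
  ultimately show ?thesis
    using N A by (intro AE_I[where N = A]) (auto simp: A_def qs_continuous_def)
qed

lemma measure_image_SUP_eq_0_iff:
  assumes "A \<in> sets M"
  shows "(SUP \<nu>\<in>measure ` \<PP>. total_variation M \<nu> A) = 0 \<longleftrightarrow> (\<forall>P\<in>\<PP>. emeasure P A = 0)"
proof -
  have "total_variation M (measure P) A = emeasure P A" if "P \<in> \<PP>" for P
    using prob[OF that] assms by (intro total_variation_measure prob_space.finite_measure) auto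
  then show ?thesis unfolding bot_ennreal[symmetric] SUP_bot_conv by simp
qed

lemma qs_continuous_abs_measure:
  assumes "\<mu> \<in> ca_dom M \<PP>"
  shows "qs_continuous M \<PP> (abs_measure M \<mu>)"
  unfolding qs_continuous_def
proof (intro conjI ballI impI)
  fix A assume A: "A \<in> sets M" and "\<forall>P\<in>\<PP>. emeasure P A = 0"
  then have "total_variation M \<mu> A = 0"
    using assms measure_image_SUP_eq_0_iff[OF A] by (auto simp: ca_dom_def dominated_def)
  then show "emeasure (abs_measure M \<mu>) A = 0"
    using assms A by (simp add: emeasure_abs_measure[OF ca_signed_additive] ca_dom_def)
qed simp

section \<open>Subspaces and norm closures in terms of random variables\<close>

lemma vector_subspace_fn:
  assumes U: "vector_subspace M \<PP> X U"
  shows "(\<lambda>_. 0) \<in> fn M \<PP> U"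
    and "f \<in> fn M \<PP> U \<Longrightarrow> g \<in> fn M \<PP> U \<Longrightarrow> (\<lambda>\<omega>. f \<omega> + g \<omega>) \<in> fn M \<PP> U"
    and "f \<in> fn M \<PP> U \<Longrightarrow> (\<lambda>\<omega>. c * f \<omega>) \<in> fn M \<PP> U"
proof -
  show "(\<lambda>_. 0) \<in> fn M \<PP> U" using U by (simp add: fn_def vector_subspace_def qs_zero_def)
  show "(\<lambda>\<omega>. f \<omega> + g \<omega>) \<in> fn M \<PP> U" if "f \<in> fn M \<PP> U" "g \<in> fn M \<PP> U"
  proof -
    have m: "f \<in> borel_measurable M" "g \<in> borel_measurable M" using that by (auto simp: fn_def)
    have "qs_add M \<PP> (cls f) (cls g) \<in> U" using U that by (simp add: fn_def vector_subspace_def)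
    then show ?thesis using m by (simp add: qs_add_cls fn_def)
  qed
  show "(\<lambda>\<omega>. c * f \<omega>) \<in> fn M \<PP> U" if "f \<in> fn M \<PP> U"
  proof -
    have m: "f \<in> borel_measurable M" using that by (auto simp: fn_def)
    have "qs_scale M \<PP> c (cls f) \<in> U" using U that by (simp add: fn_def vector_subspace_def)
    then show ?thesis using m by (simp add: qs_scale_cls[OF m m] fn_def)
  qed
qed

text \<open>Approximation by classes and by random variables agree because a class is determined by
  its \<open>rep\<close>; \<open>lux_norm_less_iff\<close> turns the norm of the difference into a
  ball.\<close>

lemma fn_norm_closure_iff:
  assumes A: "A \<subseteq> L0 M \<PP>"
  shows "f \<in> fn M \<PP> (norm_closure M \<PP> \<Phi> A) \<longleftrightarrow>
    f \<in> borel_measurable M \<and> (\<exists>l. lball l f) \<and>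
    (\<forall>\<epsilon>>0. \<exists>g\<in>fn M \<PP> A. \<exists>l<\<epsilon>. lball l (\<lambda>\<omega>. f \<omega> - g \<omega>))"
proof (cases "f \<in> borel_measurable M")
  case f: True
  have "(\<exists>Y\<in>A. lux_norm \<PP> \<Phi> (qs_diff M \<PP> (cls f) Y) < ennreal \<epsilon>) \<longleftrightarrow>
      (\<exists>g\<in>fn M \<PP> A. \<exists>l<\<epsilon>. lball l (\<lambda>\<omega>. f \<omega> - g \<omega>))" for \<epsilon>
  proof
    assume "\<exists>Y\<in>A. lux_norm \<PP> \<Phi> (qs_diff M \<PP> (cls f) Y) < ennreal \<epsilon>"
    then obtain Y where Y: "Y \<in> A" "lux_norm \<PP> \<Phi> (qs_diff M \<PP> (cls f) Y) < ennreal \<epsilon>" by blast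
    have r: "rep Y \<in> borel_measurable M" "cls (rep Y) = Y" using L0_rep Y(1) A by auto
    have "qs_diff M \<PP> (cls f) Y = cls (\<lambda>\<omega>. f \<omega> - rep Y \<omega>)"
      using qs_diff_cls[OF f r(1)] r(2) by simp
    then have "\<exists>l<\<epsilon>. lball l (\<lambda>\<omega>. f \<omega> - rep Y \<omega>)"
      using Y(2) f r(1) by (simp add: lux_norm_less_iff)
    moreover have "rep Y \<in> fn M \<PP> A" using r Y(1) by (simp add: fn_def)
    ultimately show "\<exists>g\<in>fn M \<PP> A. \<exists>l<\<epsilon>. lball l (\<lambda>\<omega>. f \<omega> - g \<omega>)" by blast
  next
    assume "\<exists>g\<in>fn M \<PP> A. \<exists>l<\<epsilon>. lball l (\<lambda>\<omega>. f \<omega> - g \<omega>)"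
    then obtain g l where g: "g \<in> borel_measurable M" "cls g \<in> A" and l: "l < \<epsilon>" "lball l (\<lambda>\<omega>. f \<omega> - g \<omega>)"
      by (auto simp: fn_def)
    then have "lux_norm \<PP> \<Phi> (qs_diff M \<PP> (cls f) (cls g)) < ennreal \<epsilon>"
      using f by (auto simp: qs_diff_cls lux_norm_less_iff)
    with g show "\<exists>Y\<in>A. lux_norm \<PP> \<Phi> (qs_diff M \<PP> (cls f) Y) < ennreal \<epsilon>" by blast
  qed
  moreover have "cls f \<in> LPhi M \<PP> \<Phi> \<longleftrightarrow> (\<exists>l. lball l f)"
    using f lux_norm_less_iff(2)[OF f] by (simp add: LPhi_def)
  ultimately show ?thesis using f by (simp add: fn_def norm_closure_def)
qed (simp add: fn_def)

lemma norm_closure_subset_L0: "norm_closure M \<PP> \<Phi> A \<subseteq> L0 M \<PP>"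
  by (auto simp: norm_closure_def LPhi_def)

lemma fn_subset_iff:
  assumes "A \<subseteq> L0 M \<PP>"
  shows "A \<subseteq> B \<longleftrightarrow> fn M \<PP> A \<subseteq> fn M \<PP> B"
proof
  assume sub: "fn M \<PP> A \<subseteq> fn M \<PP> B"
  show "A \<subseteq> B"
  proof
    fix X assume "X \<in> A"
    then have "cls (rep X) = X" "rep X \<in> fn M \<PP> A" using L0_rep assms by (auto simp: fn_def)
    with sub show "X \<in> B" by (auto simp: fn_def)
  qed
qed (auto simp: fn_def)

lemma norm_closure_superset:
  assumes "A \<subseteq> LPhi M \<PP> \<Phi>"
  shows "A \<subseteq> norm_closure M \<PP> \<Phi> A"
proof -
  have A: "A \<subseteq> L0 M \<PP>" using assms by (auto simp: LPhi_def)
  have "fn M \<PP> A \<subseteq> fn M \<PP> (norm_closure M \<PP> \<Phi> A)"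
  proof
    fix f assume f: "f \<in> fn M \<PP> A"
    then have "f \<in> fn M \<PP> (LPhi M \<PP> \<Phi>)" using assms by (auto simp: fn_def)
    then have "f \<in> borel_measurable M" "\<exists>l. lball l f" by (auto simp: fn_LPhi)
    moreover have "\<exists>g\<in>fn M \<PP> A. \<exists>l<\<epsilon>. lball l (\<lambda>\<omega>. f \<omega> - g \<omega>)" if "0 < \<epsilon>" for \<epsilon>
      using f that lball_zero[of "\<epsilon> / 2"] by (intro bexI[of _ f] exI[of _ "\<epsilon> / 2"]) auto
    ultimately show "f \<in> fn M \<PP> (norm_closure M \<PP> \<Phi> A)" by (simp add: fn_norm_closure_iff[OF A])
  qed
  then show ?thesis using fn_subset_iff[OF A] by blast
qed

end

section \<open>Closed sublattices\<close>

text \<open>The axioms speak of functions so that proofs stay pointwise. Lattice operations are left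
  to an extension of the locale, because the closure of \<open>Linf\<close> is used as a closed
  subspace only and then shown directly to be an ideal.\<close>

locale closed_subspace = robust_orlicz +
  fixes \<C> :: "('a \<Rightarrow> real) set set"
  assumes C_L0: "\<C> \<subseteq> L0 M \<PP>"
    and fn_lball: "f \<in> fn M \<PP> \<C> \<Longrightarrow> \<exists>l. lball l f"
    and fn_zero: "(\<lambda>_. 0) \<in> fn M \<PP> \<C>"
    and fn_add: "f \<in> fn M \<PP> \<C> \<Longrightarrow> g \<in> fn M \<PP> \<C> \<Longrightarrow> (\<lambda>\<omega>. f \<omega> + g \<omega>) \<in> fn M \<PP> \<C>"
    and fn_scale: "f \<in> fn M \<PP> \<C> \<Longrightarrow> (\<lambda>\<omega>. c * f \<omega>) \<in> fn M \<PP> \<C>"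
    and fn_closed: "f \<in> borel_measurable M \<Longrightarrow>
      (\<And>\<epsilon>. 0 < \<epsilon> \<Longrightarrow> \<exists>g\<in>fn M \<PP> \<C>. \<exists>l<\<epsilon>. lball l (\<lambda>\<omega>. f \<omega> - g \<omega>)) \<Longrightarrow> f \<in> fn M \<PP> \<C>"

lemma (in robust_orlicz) closed_subspace_norm_closure:
  assumes U: "vector_subspace M \<PP> (LPhi M \<PP> \<Phi>) U"
  shows "closed_subspace M \<PP> \<Phi> (norm_closure M \<PP> \<Phi> U)"
proof unfold_locales
  let ?F = "fn M \<PP> (norm_closure M \<PP> \<Phi> U)"
  have LPhi: "U \<subseteq> LPhi M \<PP> \<Phi>" using U by (simp add: vector_subspace_def)
  then have L0: "U \<subseteq> L0 M \<PP>" by (auto simp: LPhi_def)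
  note iff = fn_norm_closure_iff[OF L0]
  note U_fn = vector_subspace_fn[OF U]
  have U_bm: "g \<in> borel_measurable M" if "g \<in> fn M \<PP> U" for g using that by (simp add: fn_def)
  show "norm_closure M \<PP> \<Phi> U \<subseteq> L0 M \<PP>" by (rule norm_closure_subset_L0)
  show "\<exists>l. lball l f" if "f \<in> ?F" for f using that by (simp add: iff)
  have "fn M \<PP> U \<subseteq> ?F" using norm_closure_superset[OF LPhi] by (auto simp: fn_def)
  then show "(\<lambda>_. 0) \<in> ?F" using U_fn by blast
  show "(\<lambda>\<omega>. f \<omega> + g \<omega>) \<in> ?F" if f: "f \<in> ?F" and g: "g \<in> ?F" for f g
    unfolding iff
  proof (intro conjI allI impI)
    have m: "f \<in> borel_measurable M" "g \<in> borel_measurable M" using f g by (auto simp: iff)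
    then show "(\<lambda>\<omega>. f \<omega> + g \<omega>) \<in> borel_measurable M" by measurable
    show "\<exists>l. lball l (\<lambda>\<omega>. f \<omega> + g \<omega>)" using f g lball_add[OF m] unfolding iff by blast
    fix \<epsilon> :: real assume "0 < \<epsilon>"
    then have "0 < \<epsilon> / 2" by simp
    then obtain f' l g' k where *: "f' \<in> fn M \<PP> U" "l < \<epsilon> / 2" "lball l (\<lambda>\<omega>. f \<omega> - f' \<omega>)"
      "g' \<in> fn M \<PP> U" "k < \<epsilon> / 2" "lball k (\<lambda>\<omega>. g \<omega> - g' \<omega>)"
      using f g unfolding iff by meson
    have "lball (l + k) (\<lambda>\<omega>. (f \<omega> - f' \<omega>) + (g \<omega> - g' \<omega>))"
      using * m U_bm by (intro lball_add) auto
    then have "lball (l + k) (\<lambda>\<omega>. (f \<omega> + g \<omega>) - (f' \<omega> + g' \<omega>))" by (simp add: algebra_simps)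
    with * show "\<exists>h\<in>fn M \<PP> U. \<exists>l<\<epsilon>. lball l (\<lambda>\<omega>. f \<omega> + g \<omega> - h \<omega>)"
      by (intro bexI[of _ "\<lambda>\<omega>. f' \<omega> + g' \<omega>"] exI[of _ "l + k"] conjI U_fn) auto
  qed
  show "(\<lambda>\<omega>. c * f \<omega>) \<in> ?F" if f: "f \<in> ?F" for f c
  \<comment> \<open>Multiplication by 0 would lead to radius 0, which \<open>lux_ball\<close>
    excludes.\<close>
  proof (cases "c = 0")
    case True
    then show ?thesis using \<open>(\<lambda>_. 0) \<in> ?F\<close> by simp
  next
    case c: False
    show ?thesis
      unfolding iff
    proof (intro conjI allI impI)
      have m: "f \<in> borel_measurable M" using f by (auto simp: iff)
      then show "(\<lambda>\<omega>. c * f \<omega>) \<in> borel_measurable M" by measurable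
      show "\<exists>l. lball l (\<lambda>\<omega>. c * f \<omega>)" using f lball_scale c unfolding iff by blast
      fix \<epsilon> :: real assume "0 < \<epsilon>"
      then have "0 < \<epsilon> / \<bar>c\<bar>" using c by simp
      then obtain g l where *: "g \<in> fn M \<PP> U" "l < \<epsilon> / \<bar>c\<bar>" "lball l (\<lambda>\<omega>. f \<omega> - g \<omega>)"
        using f unfolding iff by meson
      have "lball (\<bar>c\<bar> * l) (\<lambda>\<omega>. c * f \<omega> - c * g \<omega>)"
        using lball_scale[OF *(3) c] by (simp add: algebra_simps)
      moreover have "\<bar>c\<bar> * l < \<epsilon>" using *(2) c by (simp add: field_simps)
      ultimately show "\<exists>h\<in>fn M \<PP> U. \<exists>l<\<epsilon>. lball l (\<lambda>\<omega>. c * f \<omega> - h \<omega>)"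
        using U_fn(3)[OF *(1), of c] by (intro bexI[of _ "\<lambda>\<omega>. c * g \<omega>"] exI[of _ "\<bar>c\<bar> * l"] conjI)
    qed
  qed
  \<comment> \<open>One half of \<epsilon> is spent on reaching a point of the closure, the other on
    reaching an element of \<open>U\<close> near that point.\<close>
  show "f \<in> ?F"
    if m: "f \<in> borel_measurable M" and
      approx: "\<And>\<epsilon>. 0 < \<epsilon> \<Longrightarrow> \<exists>g\<in>?F. \<exists>l<\<epsilon>. lball l (\<lambda>\<omega>. f \<omega> - g \<omega>)" for f
    unfolding iff
  proof (intro conjI allI impI m)
    obtain g l where g: "g \<in> ?F" "lball l (\<lambda>\<omega>. f \<omega> - g \<omega>)" using approx[of 1] by auto
    moreover obtain k where "lball k g" using g by (auto simp: iff)
    ultimately have *: "g \<in> ?F" "lball l (\<lambda>\<omega>. f \<omega> - g \<omega>)" "lball k g" by auto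
    then have "lball (l + k) (\<lambda>\<omega>. (f \<omega> - g \<omega>) + g \<omega>)"
      using m by (intro lball_add) (auto simp: iff)
    then show "\<exists>l. lball l f" by auto
    fix \<epsilon> :: real assume "0 < \<epsilon>"
    then have e: "0 < \<epsilon> / 2" by simp
    obtain g l where g: "g \<in> ?F" "l < \<epsilon> / 2" "lball l (\<lambda>\<omega>. f \<omega> - g \<omega>)"
      using approx[OF e] by blast
    obtain h k where h: "h \<in> fn M \<PP> U" "k < \<epsilon> / 2" "lball k (\<lambda>\<omega>. g \<omega> - h \<omega>)"
      using g(1) e unfolding iff by meson
    have "lball (l + k) (\<lambda>\<omega>. (f \<omega> - g \<omega>) + (g \<omega> - h \<omega>))"
      using g h m U_bm by (intro lball_add) (auto simp: iff)
    with g h show "\<exists>h\<in>fn M \<PP> U. \<exists>l<\<epsilon>. lball l (\<lambda>\<omega>. f \<omega> - h \<omega>)"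
      by (intro bexI[of _ h] exI[of _ "l + k"] conjI) auto
  qed
qed

context closed_subspace
begin

abbreviation "FC \<equiv> fn M \<PP> \<C>"

lemma fn_measurable: "f \<in> FC \<Longrightarrow> f \<in> borel_measurable M"
  by (simp add: fn_def)

lemma rep_fn: "X \<in> \<C> \<Longrightarrow> rep X \<in> FC"
  using L0_rep C_L0 by (auto simp: fn_def)

lemma cls_rep: "X \<in> \<C> \<Longrightarrow> cls (rep X) = X"
  using L0_rep C_L0 by auto

lemma fn_cls: "f \<in> FC \<Longrightarrow> cls f \<in> \<C>"
  by (simp add: fn_def)

lemma fn_diff: "f \<in> FC \<Longrightarrow> g \<in> FC \<Longrightarrow> (\<lambda>\<omega>. f \<omega> - g \<omega>) \<in> FC"
  using fn_add[OF _ fn_scale[of g "-1"]] by simp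

lemma fn_sum: "(\<And>i. i < n \<Longrightarrow> f i \<in> FC) \<Longrightarrow> (\<lambda>\<omega>. \<Sum>i<n. f i \<omega>) \<in> FC" for n :: nat
  by (induction n) (auto intro: fn_zero fn_add)

lemma vector_subspace_C: "vector_subspace M \<PP> (LPhi M \<PP> \<Phi>) \<C>"
  unfolding vector_subspace_def
proof (intro conjI ballI allI)
  show "\<C> \<subseteq> LPhi M \<PP> \<Phi>"
    using fn_lball fn_measurable by (subst fn_subset_iff[OF C_L0]) (auto simp: fn_LPhi)
  show "qs_zero M \<PP> \<in> \<C>" unfolding qs_zero_def by (intro fn_cls fn_zero)
  show "qs_add M \<PP> X Y \<in> \<C>" if "X \<in> \<C>" "Y \<in> \<C>" for X Y
    unfolding qs_add_def by (intro fn_cls fn_add rep_fn that)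
  show "qs_scale M \<PP> c X \<in> \<C>" if "X \<in> \<C>" for c X
    unfolding qs_scale_def by (intro fn_cls fn_scale rep_fn that)
qed

text \<open>The right side ranges over all measurable \<open>f\<close>: domination by
  \<open>g\<close> puts \<open>f\<close> into every ball that contains \<open>g\<close>, hence into
  \<open>LPhi\<close>.\<close>

lemma lattice_ideal_iff:
  "lattice_ideal M \<PP> (LPhi M \<PP> \<Phi>) \<C> \<longleftrightarrow>
    (\<forall>f g. f \<in> borel_measurable M \<longrightarrow> g \<in> FC \<longrightarrow> (\<forall>\<^sub>F \<omega> in qs. \<bar>f \<omega>\<bar> \<le> \<bar>g \<omega>\<bar>) \<longrightarrow> f \<in> FC)"
    (is "?L \<longleftrightarrow> ?R")
proof
  assume L: ?L
  show ?R
  proof (intro allI impI)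
    fix f g assume f: "f \<in> borel_measurable M" and g: "g \<in> FC" and le: "\<forall>\<^sub>F \<omega> in qs. \<bar>f \<omega>\<bar> \<le> \<bar>g \<omega>\<bar>"
    obtain l where "lball l g" using fn_lball[OF g] by blast
    then have "lball l f" using lball_mono le by blast
    then have "cls f \<in> LPhi M \<PP> \<Phi>" using f lux_norm_less_iff(2)[OF f] by (auto simp: LPhi_def)
    moreover have "qs_le \<PP> (qs_abs M \<PP> (cls f)) (qs_abs M \<PP> (cls g))"
      using le f fn_measurable[OF g] by (simp add: qs_abs_cls[of f f] qs_abs_cls[of g g] qs_le_cls)
    ultimately show "f \<in> FC" using L f fn_cls[OF g] by (auto simp: lattice_ideal_def fn_def)
  qed
next
  assume R: ?R
  show ?L
    unfolding lattice_ideal_def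
  proof (intro conjI ballI impI vector_subspace_C)
    fix X Y assume X: "X \<in> LPhi M \<PP> \<Phi>" and Y: "Y \<in> \<C>" and le: "qs_le \<PP> (qs_abs M \<PP> X) (qs_abs M \<PP> Y)"
    have X': "rep X \<in> borel_measurable M" "cls (rep X) = X" using X L0_rep by (auto simp: LPhi_def)
    have "\<forall>\<^sub>F \<omega> in qs. \<bar>rep X \<omega>\<bar> \<le> \<bar>rep Y \<omega>\<bar>"
      using le X' fn_measurable[OF rep_fn[OF Y]] by (simp add: qs_abs_def qs_le_cls)
    then have "rep X \<in> FC" using R X'(1) rep_fn[OF Y] by blast
    then show "X \<in> \<C>" using X'(2) fn_cls by metis
  qed
qed

end

section \<open>The Banach lattice property\<close>

text \<open>The absolute value is enough as lattice operation, since \<open>max\<close> and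
  \<open>min\<close> are half of \<open>f + g\<close> plus or minus
  \<open>\<bar>f - g\<bar>\<close>.\<close>

locale closed_sublattice = closed_subspace +
  assumes fn_one: "(\<lambda>_. 1) \<in> FC"
    and fn_abs: "f \<in> FC \<Longrightarrow> (\<lambda>\<omega>. \<bar>f \<omega>\<bar>) \<in> FC"

lemma (in robust_orlicz) closed_sublattice_norm_closure:
  assumes U: "vector_sublattice M \<PP> (LPhi M \<PP> \<Phi>) U" and one: "qs_one M \<PP> \<in> U"
  shows "closed_sublattice M \<PP> \<Phi> (norm_closure M \<PP> \<Phi> U)"
proof -
  have sub: "vector_subspace M \<PP> (LPhi M \<PP> \<Phi>) U" using U by (simp add: vector_sublattice_def)
  interpret closed_subspace M \<PP> \<Phi> "norm_closure M \<PP> \<Phi> U"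
    by (rule closed_subspace_norm_closure[OF sub])
  have LPhi: "U \<subseteq> LPhi M \<PP> \<Phi>" using sub by (simp add: vector_subspace_def)
  then have L0: "U \<subseteq> L0 M \<PP>" by (auto simp: LPhi_def)
  have U_abs: "(\<lambda>\<omega>. \<bar>g \<omega>\<bar>) \<in> fn M \<PP> U" if g: "g \<in> fn M \<PP> U" for g
  proof -
    have g': "(\<lambda>\<omega>. -1 * g \<omega>) \<in> fn M \<PP> U" by (rule vector_subspace_fn(3)[OF sub g])
    have m: "g \<in> borel_measurable M" "(\<lambda>\<omega>. -1 * g \<omega>) \<in> borel_measurable M"
      using g g' by (auto simp: fn_def)
    have "qs_sup M \<PP> (cls g) (cls (\<lambda>\<omega>. -1 * g \<omega>)) \<in> U"
      using U g g' unfolding fn_def vector_sublattice_def by blast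
    moreover have "(\<lambda>\<omega>. max (g \<omega>) (-1 * g \<omega>)) = (\<lambda>\<omega>. \<bar>g \<omega>\<bar>)" by auto
    ultimately have "cls (\<lambda>\<omega>. \<bar>g \<omega>\<bar>) \<in> U" by (simp only: qs_sup_cls[OF m])
    then show ?thesis using m by (simp add: fn_def)
  qed
  show ?thesis
  proof unfold_locales
    show "(\<lambda>_. 1) \<in> FC"
      using one norm_closure_superset[OF LPhi] by (auto simp: fn_def qs_one_def)
    show "(\<lambda>\<omega>. \<bar>f \<omega>\<bar>) \<in> FC" if f: "f \<in> FC" for f
      unfolding fn_norm_closure_iff[OF L0]
    proof (intro conjI allI impI)
      have m: "f \<in> borel_measurable M" by (rule fn_measurable[OF f])
      then show "(\<lambda>\<omega>. \<bar>f \<omega>\<bar>) \<in> borel_measurable M" by measurable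
      obtain l where "lball l f" using fn_lball[OF f] by blast
      then have "lball l (\<lambda>\<omega>. \<bar>f \<omega>\<bar>)" by (rule lball_mono) auto
      then show "\<exists>l. lball l (\<lambda>\<omega>. \<bar>f \<omega>\<bar>)" by blast
      fix \<epsilon> :: real assume "0 < \<epsilon>"
      then obtain g l where g: "g \<in> fn M \<PP> U" "l < \<epsilon>" "lball l (\<lambda>\<omega>. f \<omega> - g \<omega>)"
        using f unfolding fn_norm_closure_iff[OF L0] by blast
      \<comment> \<open>The absolute value is nonexpansive: the reverse triangle inequality bounds
        the new error by the old one.\<close>
      have "lball l (\<lambda>\<omega>. \<bar>f \<omega>\<bar> - \<bar>g \<omega>\<bar>)"
        by (rule lball_mono[OF g(3)]) (auto intro!: always_eventually)
      with g(2) U_abs[OF g(1)] show "\<exists>h\<in>fn M \<PP> U. \<exists>l<\<epsilon>. lball l (\<lambda>\<omega>. \<bar>f \<omega>\<bar> - h \<omega>)"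
        by (intro bexI[of _ "\<lambda>\<omega>. \<bar>g \<omega>\<bar>"] exI[of _ l] conjI)
    qed
  qed
qed

context closed_sublattice
begin

lemma fn_max: "(\<lambda>\<omega>. max (f \<omega>) (g \<omega>)) \<in> FC" if "f \<in> FC" "g \<in> FC"
proof -
  have "(\<lambda>\<omega>. 1 / 2 * ((f \<omega> + g \<omega>) + \<bar>f \<omega> - g \<omega>\<bar>)) \<in> FC"
    by (intro fn_scale fn_add fn_abs fn_diff that)
  moreover have "(\<lambda>\<omega>. 1 / 2 * ((f \<omega> + g \<omega>) + \<bar>f \<omega> - g \<omega>\<bar>)) = (\<lambda>\<omega>. max (f \<omega>) (g \<omega>))"
    by (auto simp: max_def field_simps)
  ultimately show ?thesis by simp
qed

lemma fn_min: "(\<lambda>\<omega>. min (f \<omega>) (g \<omega>)) \<in> FC" if "f \<in> FC" "g \<in> FC"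
proof -
  have "(\<lambda>\<omega>. 1 / 2 * ((f \<omega> + g \<omega>) - \<bar>f \<omega> - g \<omega>\<bar>)) \<in> FC"
    by (intro fn_scale fn_add fn_abs fn_diff that)
  moreover have "(\<lambda>\<omega>. 1 / 2 * ((f \<omega> + g \<omega>) - \<bar>f \<omega> - g \<omega>\<bar>)) = (\<lambda>\<omega>. min (f \<omega>) (g \<omega>))"
    by (auto simp: min_def field_simps)
  ultimately show ?thesis by simp
qed

text \<open>Completeness in the form that is used. For each \<open>P\<close> the expectations of
  \<open>\<bar>g n\<bar>\<close> are summable, so the series converges quasi surely; the Fatou
  property makes its tails small in norm, and closedness puts the sum into \<C>.\<close>

lemma fn_series:
  assumes g: "\<And>n::nat. g n \<in> FC" and b: "\<And>n. lball ((1 / 2) ^ n) (g n)"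
  obtains s where "s \<in> FC" "\<And>n. \<forall>\<^sub>F \<omega> in qs. \<bar>g n \<omega>\<bar> \<le> s \<omega>"
proof -
  \<comment> \<open>Where the series diverges the value of the sum is unspecified; quasi surely this
    does not occur.\<close>
  define s where "s \<omega> = (\<Sum>n. \<bar>g n \<omega>\<bar>)" for \<omega>
  note [measurable] = fn_measurable[OF g]
  have s_m: "s \<in> borel_measurable M" unfolding s_def by measurable
  have summ: "\<forall>\<^sub>F \<omega> in qs. summable (\<lambda>n. \<bar>g n \<omega>\<bar>)"
    unfolding eventually_quasi_surely
  proof
    fix P assume P: "P \<in> \<PP>"
    note [measurable] = measurable_P[OF P fn_measurable[OF g]]
    obtain K where K: "0 < K"
      "\<And>f l. f \<in> borel_measurable M \<Longrightarrow> lball l f \<Longrightarrow> (\<integral>\<^sup>+\<omega>. ennreal \<bar>f \<omega>\<bar> \<partial>P) \<le> ennreal (K * l)"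
      using lball_nn_integral_bound[OF P] by blast
    have "(\<integral>\<^sup>+\<omega>. (\<Sum>n. ennreal \<bar>g n \<omega>\<bar>) \<partial>P) = (\<Sum>n. \<integral>\<^sup>+\<omega>. ennreal \<bar>g n \<omega>\<bar> \<partial>P)"
      by (intro nn_integral_suminf) measurable
    also have "\<dots> \<le> (\<Sum>n. ennreal (K * (1 / 2) ^ n))"
      by (intro suminf_le K(2) fn_measurable g b) auto
    also have "\<dots> < \<infinity>"
    proof -
      have "summable (\<lambda>n. K * (1 / 2 :: real) ^ n)" by (intro summable_mult summable_geometric) simp
      then show ?thesis using K(1) by (subst suminf_ennreal2) auto
    qed
    finally have "AE \<omega> in P. (\<Sum>n. ennreal \<bar>g n \<omega>\<bar>) \<noteq> \<infinity>"
      by (intro nn_integral_PInf_AE) auto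
    then show "AE \<omega> in P. summable (\<lambda>n. \<bar>g n \<omega>\<bar>)"
      by eventually_elim (auto intro: summable_suminf_not_top)
  qed
  \<comment> \<open>The radii sum to \<open>2 * (1 / 2) ^ n - 2 * (1 / 2) ^ (n + k)\<close>, which
    is 0 for \<open>k = 0\<close>. The extra \<open>(1 / 2) ^ n\<close> keeps the radius positive,
    as \<open>lux_ball\<close> requires.\<close>
  have partial: "lball (3 * (1 / 2) ^ n - 2 * (1 / 2) ^ (n + k)) (\<lambda>\<omega>. \<Sum>i<k. \<bar>g (n + i) \<omega>\<bar>)" for n k
  proof (induction k)
    case 0
    show ?case by (auto intro!: lball_zero)
  next
    case (Suc k)
    have "lball ((1 / 2) ^ (n + k)) (\<lambda>\<omega>. \<bar>g (n + k) \<omega>\<bar>)"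
      by (rule lball_mono[OF b[of "n + k"]]) auto
    with Suc have "lball ((3 * (1 / 2) ^ n - 2 * (1 / 2) ^ (n + k)) + (1 / 2) ^ (n + k))
        (\<lambda>\<omega>. (\<Sum>i<k. \<bar>g (n + i) \<omega>\<bar>) + \<bar>g (n + k) \<omega>\<bar>)"
      by (intro lball_add) measurable
    then show ?case by simp
  qed
  have tail: "lball (3 * (1 / 2) ^ n) (\<lambda>\<omega>. s \<omega> - (\<Sum>i<n. \<bar>g i \<omega>\<bar>))" for n
  proof (rule lball_Fatou)
    show "lball (3 * (1 / 2) ^ n) (\<lambda>\<omega>. \<Sum>i<k. \<bar>g (n + i) \<omega>\<bar>)" for k
      by (rule lball_mono[OF partial[of n k]]) auto
    show "\<forall>\<^sub>F \<omega> in qs. (\<lambda>k. \<Sum>i<k. \<bar>g (n + i) \<omega>\<bar>) \<longlonglongrightarrow> s \<omega> - (\<Sum>i<n. \<bar>g i \<omega>\<bar>)"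
      using summ
    proof eventually_elim
      fix \<omega> assume sm: "summable (\<lambda>n. \<bar>g n \<omega>\<bar>)"
      then have "(\<lambda>i. \<bar>g (i + n) \<omega>\<bar>) sums (s \<omega> - (\<Sum>i<n. \<bar>g i \<omega>\<bar>))"
        unfolding s_def by (intro sums_split_initial_segment summable_sums)
      then show "(\<lambda>k. \<Sum>i<k. \<bar>g (n + i) \<omega>\<bar>) \<longlonglongrightarrow> s \<omega> - (\<Sum>i<n. \<bar>g i \<omega>\<bar>)"
        by (simp add: sums_def add.commute)
    qed
  qed measurable
  show ?thesis
  proof (rule that)
    show "s \<in> FC"
    proof (rule fn_closed[OF s_m])
      fix \<epsilon> :: real assume "0 < \<epsilon>"
      then obtain n where "(1 / 2) ^ n < \<epsilon> / 3"
        using real_arch_pow_inv[of "\<epsilon> / 3" "1 / 2"] by auto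
      then have "3 * (1 / 2) ^ n < \<epsilon>" by simp
      moreover have "(\<lambda>\<omega>. \<Sum>i<n. \<bar>g i \<omega>\<bar>) \<in> FC" by (intro fn_sum fn_abs g)
      ultimately show "\<exists>h\<in>FC. \<exists>l<\<epsilon>. lball l (\<lambda>\<omega>. s \<omega> - h \<omega>)"
        using tail[of n] by (intro bexI[of _ "\<lambda>\<omega>. \<Sum>i<n. \<bar>g i \<omega>\<bar>"] exI[of _ "3 * (1 / 2) ^ n"] conjI)
    qed
    show "\<forall>\<^sub>F \<omega> in qs. \<bar>g n \<omega>\<bar> \<le> s \<omega>" for n
      using summ
    proof eventually_elim
      fix \<omega> assume "summable (\<lambda>n. \<bar>g n \<omega>\<bar>)"
      then show "\<bar>g n \<omega>\<bar> \<le> s \<omega>"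
        using sum_le_suminf[of "\<lambda>n. \<bar>g n \<omega>\<bar>" "{n}"] by (simp add: s_def)
    qed
  qed
qed

text \<open>Positive functionals on a Banach lattice are automatically continuous.\<close>

lemma integral_bounded_by_norm:
  assumes N: "qs_continuous M \<PP> N" and int: "\<And>f. f \<in> FC \<Longrightarrow> integrable N f"
  obtains K where "0 < K" "\<And>f l. f \<in> FC \<Longrightarrow> lball l f \<Longrightarrow> (\<integral>\<omega>. \<bar>f \<omega>\<bar> \<partial>N) \<le> K * l"
proof (rule ccontr)
  assume "\<not> thesis"
  \<comment> \<open>The choice \<open>K = 4 ^ n\<close> leaves room for two factors
    \<open>2 ^ n\<close>: one makes the radii of the rescaled functions summable, the other lets
    their integrals grow without bound.\<close>
  then have "\<exists>f l. f \<in> FC \<and> lball l f \<and> 4 ^ n * l < (\<integral>\<omega>. \<bar>f \<omega>\<bar> \<partial>N)" for n :: nat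
    using that[of "4 ^ n"] by (force simp: not_le)
  then obtain f l where f: "\<And>n. f n \<in> FC" "\<And>n. lball (l n) (f n)"
    "\<And>n. 4 ^ n * l n < (\<integral>\<omega>. \<bar>f n \<omega>\<bar> \<partial>N)" for n :: nat
    by metis
  define c where "c n = 1 / (2 ^ n * l n)" for n
  have l: "0 < l n" for n by (rule lball_pos[OF f(2)])
  have c: "0 < c n" "c n * l n = (1 / 2) ^ n" for n
    using l[of n] by (auto simp: c_def field_simps)
  define g where "g n \<omega> = c n * f n \<omega>" for n \<omega>
  have g: "g n \<in> FC" for n unfolding g_def by (intro fn_scale f)
  have lball_g: "lball (\<bar>c n\<bar> * l n) (g n)" for n
    unfolding g_def using c(1)[of n] by (intro lball_scale f) auto
  have lball_half: "lball ((1 / 2) ^ n) (g n)" for n using lball_g[of n] c[of n] by simp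
  \<comment> \<open>The majorant \<open>s\<close> lies in \<C> and is therefore integrable, yet it
    dominates every \<open>g n\<close>.\<close>
  obtain s where s: "s \<in> FC" "\<And>n. \<forall>\<^sub>F \<omega> in qs. \<bar>g n \<omega>\<bar> \<le> s \<omega>"
    using fn_series[OF g lball_half] by blast
  have "2 ^ n < (\<integral>\<omega>. s \<omega> \<partial>N)" for n
  proof -
    note [measurable] = fn_measurable[OF g] fn_measurable[OF s(1)]
    have "2 ^ n = c n * (4 ^ n * l n)"
      using l[of n] by (simp add: c_def field_simps flip: power_mult_distrib)
    also have "\<dots> < c n * (\<integral>\<omega>. \<bar>f n \<omega>\<bar> \<partial>N)" using f(3) c(1) by simp
    also have "\<dots> = (\<integral>\<omega>. \<bar>g n \<omega>\<bar> \<partial>N)" using c(1)[of n] by (simp add: g_def abs_mult)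
    also have "\<dots> \<le> (\<integral>\<omega>. s \<omega> \<partial>N)"
    proof (intro integral_mono_AE int s fn_abs g)
      show "AE \<omega> in N. \<bar>g n \<omega>\<bar> \<le> s \<omega>" by (rule AE_qs_continuous[OF N _ s(2)]) measurable
    qed
    finally show ?thesis .
  qed
  moreover obtain n where "(\<integral>\<omega>. s \<omega> \<partial>N) < 2 ^ n" using real_arch_pow[of 2] by auto
  ultimately show False using less_asym by blast
qed

section \<open>Measures that integrate all of \<C>\<close>

lemma
  assumes \<mu>: "\<mu> \<in> ca_dom M \<PP>" and int: "\<And>X. X \<in> \<C> \<Longrightarrow> abs_integrable M \<mu> X" and f: "f \<in> FC"
  shows integrable_abs_measure: "integrable (abs_measure M \<mu>) f"
    and abs_integral_cls: "abs_integral M \<mu> (cls f) = integral\<^sup>L (abs_measure M \<mu>) f"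
proof -
  have fm: "f \<in> borel_measurable M" by (rule fn_measurable[OF f])
  note rm = rep_cls(1)[OF fm]
  note [measurable] = fm rm
  have AE: "AE \<omega> in abs_measure M \<mu>. rep (cls f) \<omega> = f \<omega>"
    by (rule AE_qs_continuous[OF qs_continuous_abs_measure[OF \<mu>] _ rep_cls(2)[OF fm]]) measurable
  have m: "f \<in> borel_measurable (abs_measure M \<mu>)" "rep (cls f) \<in> borel_measurable (abs_measure M \<mu>)"
    using fm rm measurable_cong_sets[OF sets_abs_measure refl] by blast+
  show "integrable (abs_measure M \<mu>) f"
    using int[OF fn_cls[OF f]] integrable_cong_AE[OF m(2,1) AE] by (simp add: abs_integrable_def)
  show "abs_integral M \<mu> (cls f) = integral\<^sup>L (abs_measure M \<mu>) f"
    unfolding abs_integral_def by (rule integral_cong_AE[OF m(2,1) AE])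
qed

text \<open>Norm continuity follows from integrability through
  \<open>integral_bounded_by_norm\<close>, with modulus \<open>\<epsilon> / K\<close>. What remains
  to compare with \<open>ca_sigma\<close> is order continuity alone.\<close>

lemma ca_cont_eq: "ca_cont M \<PP> \<Phi> \<C> = {\<mu> \<in> ca_dom M \<PP>. \<forall>X\<in>\<C>. abs_integrable M \<mu> X}"
proof -
  have "norm_continuous_on M \<PP> \<Phi> \<C> (abs_integral M \<mu>)"
    if \<mu>: "\<mu> \<in> ca_dom M \<PP>" and int: "\<forall>X\<in>\<C>. abs_integrable M \<mu> X" for \<mu>
  proof -
    let ?N = "abs_measure M \<mu>"
    have int_fn: "integrable ?N f" if "f \<in> FC" for f
      using integrable_abs_measure[OF \<mu> _ that] int by blast
    obtain K where K: "0 < K" "\<And>f l. f \<in> FC \<Longrightarrow> lball l f \<Longrightarrow> (\<integral>\<omega>. \<bar>f \<omega>\<bar> \<partial>?N) \<le> K * l"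
      using integral_bounded_by_norm[OF qs_continuous_abs_measure[OF \<mu>] int_fn] by blast
    show ?thesis
      unfolding norm_continuous_on_def
    proof (intro ballI allI impI)
      fix X and \<epsilon> :: real assume X: "X \<in> \<C>" and \<epsilon>: "0 < \<epsilon>"
      show "\<exists>\<delta>>0. \<forall>Y\<in>\<C>. lux_norm \<PP> \<Phi> (qs_diff M \<PP> Y X) < ennreal \<delta> \<longrightarrow>
          \<bar>abs_integral M \<mu> Y - abs_integral M \<mu> X\<bar> < \<epsilon>"
      proof (intro exI[of _ "\<epsilon> / K"] conjI ballI impI)
        show "0 < \<epsilon> / K" using \<epsilon> K by simp
        fix Y assume Y: "Y \<in> \<C>" and less: "lux_norm \<PP> \<Phi> (qs_diff M \<PP> Y X) < ennreal (\<epsilon> / K)"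
        have d: "(\<lambda>\<omega>. rep Y \<omega> - rep X \<omega>) \<in> FC" by (intro fn_diff rep_fn X Y)
        obtain l where l: "l < \<epsilon> / K" "lball l (\<lambda>\<omega>. rep Y \<omega> - rep X \<omega>)"
          using less unfolding qs_diff_def lux_norm_less_iff(1)[OF fn_measurable[OF d]] by blast
        have "abs_integral M \<mu> Y - abs_integral M \<mu> X = (\<integral>\<omega>. rep Y \<omega> - rep X \<omega> \<partial>?N)"
          unfolding abs_integral_def by (intro Bochner_Integration.integral_diff[symmetric] int_fn rep_fn X Y)
        also have "\<bar>\<dots>\<bar> \<le> (\<integral>\<omega>. \<bar>rep Y \<omega> - rep X \<omega>\<bar> \<partial>?N)" by (rule integral_abs_bound)
        also have "\<dots> \<le> K * l" by (rule K(2)[OF d l(2)])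
        also have "\<dots> < \<epsilon>" using l(1) K(1) by (simp add: field_simps)
        finally show "\<bar>abs_integral M \<mu> Y - abs_integral M \<mu> X\<bar> < \<epsilon>" .
      qed
    qed
  qed
  then show ?thesis by (auto simp: ca_cont_def)
qed

lemma measure_in_ca_cont:
  assumes P: "P \<in> \<PP>"
  shows "measure P \<in> ca_cont M \<PP> \<Phi> \<C>"
  unfolding ca_cont_eq
proof (intro CollectI conjI ballI)
  interpret prob_space P using prob[OF P] by simp
  have sets: "sets P = sets M" using prob[OF P] by simp
  have fm: "finite_measure P" by unfold_locales
  have "dominated M {measure P} (measure ` \<PP>)"
    using P unfolding dominated_def
    by (auto simp: measure_image_SUP_eq_0_iff total_variation_measure[OF fm sets])
  then show "measure P \<in> ca_dom M \<PP>"
    using measure_in_ca_plus[OF fm sets] by (simp add: ca_dom_def ca_plus_def)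
  fix X assume X: "X \<in> \<C>"
  obtain l where l: "lball l (rep X)" using fn_lball[OF rep_fn[OF X]] by blast
  obtain K where "\<And>f l. f \<in> borel_measurable M \<Longrightarrow> lball l f \<Longrightarrow> (\<integral>\<^sup>+\<omega>. ennreal \<bar>f \<omega>\<bar> \<partial>P) \<le> ennreal (K * l)"
    using lball_nn_integral_bound[OF P] by blast
  from this[OF fn_measurable[OF rep_fn[OF X]] l] have "(\<integral>\<^sup>+\<omega>. ennreal \<bar>rep X \<omega>\<bar> \<partial>P) < \<infinity>" by (simp add: order_le_less_trans)
  then show "abs_integrable M (measure P) X"
    unfolding abs_integrable_def abs_measure_measure[OF fm sets] integrable_iff_bounded
    using measurable_P[OF P fn_measurable[OF rep_fn[OF X]]] by simp
qed

text \<open>This half of the equivalence in (1) is built into \<open>ca_dom\<close>; the converse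
  domination carries the information.\<close>

lemma dominated_ca_sigma_plus: "dominated M (ca_sigma_plus M \<PP> \<C>) (measure ` \<PP>)"
proof -
  have "dominated M {\<mu>} (measure ` \<PP>)" if "\<mu> \<in> ca_sigma_plus M \<PP> \<C>" for \<mu>
    using that by (simp add: ca_sigma_plus_def ca_sigma_def ca_dom_def)
  then show ?thesis
    unfolding dominated_def bot_ennreal[symmetric] SUP_bot_conv by blast
qed

lemma equivalent_if_ca_cont_eq_ca_sigma:
  assumes "ca_cont M \<PP> \<Phi> \<C> = ca_sigma M \<PP> \<C>"
  shows "equivalent M (measure ` \<PP>) (ca_sigma_plus M \<PP> \<C>)"
proof -
  have "measure P \<in> ca_sigma_plus M \<PP> \<C>" if P: "P \<in> \<PP>" for P
    using measure_in_ca_cont[OF P] measure_in_ca_plus[of P M] prob[OF P] assms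
    by (auto simp: ca_sigma_plus_def intro: prob_space.finite_measure)
  then have "dominated M (measure ` \<PP>) (ca_sigma_plus M \<PP> \<C>)"
    unfolding dominated_def bot_ennreal[symmetric] SUP_bot_conv by blast
  then show ?thesis using dominated_ca_sigma_plus by (simp add: equivalent_def)
qed

end

section \<open>Order completeness and ideals\<close>

text \<open>\<open>Upper\<close> quantifies only over members of the carrier, whence the
  intersection with \<X>.\<close>

lemma is_lub_qs_order:
  "is_lub (qs_order \<PP> \<X>) S A \<longleftrightarrow> S \<in> \<X> \<and> (\<forall>X\<in>A \<inter> \<X>. qs_le \<PP> X S) \<and>
    (\<forall>U\<in>\<X>. (\<forall>X\<in>A \<inter> \<X>. qs_le \<PP> X U) \<longrightarrow> qs_le \<PP> S U)"
  by (auto simp: least_def Upper_def qs_order_def)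

lemma is_glb_qs_order:
  "is_glb (qs_order \<PP> \<X>) S A \<longleftrightarrow> S \<in> \<X> \<and> (\<forall>X\<in>A \<inter> \<X>. qs_le \<PP> S X) \<and>
    (\<forall>U\<in>\<X>. (\<forall>X\<in>A \<inter> \<X>. qs_le \<PP> U X) \<longrightarrow> qs_le \<PP> U S)"
  by (auto simp: greatest_def Lower_def qs_order_def)

lemma Upper_qs_order: "Upper (qs_order \<PP> \<X>) A = {U \<in> \<X>. \<forall>X\<in>A \<inter> \<X>. qs_le \<PP> X U}"
  by (auto simp: Upper_def qs_order_def)

text \<open>Each Jordan part contributes at most the integral of \<open>\<bar>rep X\<bar>\<close>
  against the variation. The resulting factor 2 is crude but harmless for boundedness and for limits
  equal to 0.\<close>

lemma abs_signed_integral_le: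
  assumes \<mu>: "\<mu> \<in> ca M" and int: "abs_integrable M \<mu> X"
  shows "\<bar>signed_integral M \<mu> X\<bar> \<le> 2 * (\<integral>\<omega>. \<bar>rep X \<omega>\<bar> \<partial>abs_measure M \<mu>)"
proof -
  have int: "integrable (abs_measure M \<mu>) (rep X)" using int by (simp add: abs_integrable_def)
  have "\<bar>integral\<^sup>L (pos_measure M \<mu>) (rep X)\<bar> \<le> (\<integral>\<omega>. \<bar>rep X \<omega>\<bar> \<partial>abs_measure M \<mu>)"
    by (rule integral_le_of_emeasure_le(2)[OF _ _ int]) (simp_all add: emeasure_pos_le_abs[OF \<mu>])
  moreover have "\<bar>integral\<^sup>L (neg_measure M \<mu>) (rep X)\<bar> \<le> (\<integral>\<omega>. \<bar>rep X \<omega>\<bar> \<partial>abs_measure M \<mu>)"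
    by (rule integral_le_of_emeasure_le(2)[OF _ _ int]) (simp_all add: emeasure_neg_le_abs[OF \<mu>])
  ultimately show ?thesis unfolding signed_integral_def by linarith
qed

lemma signed_integral_ca_plus:
  assumes \<mu>: "\<mu> \<in> ca_plus M"
  shows "signed_integral M \<mu> X = abs_integral M \<mu> X"
proof -
  have "emeasure (neg_measure M \<mu>) (space (neg_measure M \<mu>)) = 0"
    using ca_plus_measures(2)[OF \<mu>] sets_eq_imp_space_eq[OF sets_neg_measure[of M \<mu>]] by simp
  then have "AE \<omega> in neg_measure M \<mu>. rep X \<omega> = 0"
    by (rule AE_I[rotated, OF _ sets.top]) auto
  then have "integral\<^sup>L (neg_measure M \<mu>) (rep X) = 0" by (rule integral_eq_zero_AE)
  then show ?thesis by (simp add: signed_integral_def abs_integral_def ca_plus_measures(1)[OF \<mu>])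
qed

context closed_sublattice
begin

lemma qs_le_rep: "X \<in> \<C> \<Longrightarrow> Y \<in> \<C> \<Longrightarrow> qs_le \<PP> X Y \<longleftrightarrow> (\<forall>\<^sub>F \<omega> in qs. rep X \<omega> \<le> rep Y \<omega>)"
  using qs_le_cls[OF fn_measurable[OF rep_fn] fn_measurable[OF rep_fn]] by (simp add: cls_rep)

lemma qs_le_cls_fn: "f \<in> FC \<Longrightarrow> g \<in> FC \<Longrightarrow> qs_le \<PP> (cls f) (cls g) \<longleftrightarrow> (\<forall>\<^sub>F \<omega> in qs. f \<omega> \<le> g \<omega>)"
  by (intro qs_le_cls fn_measurable)

lemma ideal_fn:
  assumes "lattice_ideal M \<PP> (LPhi M \<PP> \<Phi>) \<C>" "f \<in> borel_measurable M" "g \<in> FC"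
    and "\<forall>\<^sub>F \<omega> in qs. \<bar>f \<omega>\<bar> \<le> \<bar>g \<omega>\<bar>"
  shows "f \<in> FC"
  using assms unfolding lattice_ideal_iff by blast

lemma dedekind_sigma_complete_if_ideal:
  assumes ideal: "lattice_ideal M \<PP> (LPhi M \<PP> \<Phi>) \<C>"
  shows "dedekind_sigma_complete \<PP> \<C>"
  unfolding dedekind_sigma_complete_def
proof (intro allI impI, elim conjE)
  fix A assume A: "A \<subseteq> \<C>" "A \<noteq> {}" "countable A" and "Upper (qs_order \<PP> \<C>) A \<noteq> {}"
  then obtain U where U: "U \<in> \<C>" "\<And>X. X \<in> A \<Longrightarrow> qs_le \<PP> X U"
    unfolding Upper_qs_order by blast
  obtain X :: "nat \<Rightarrow> ('a \<Rightarrow> real) set" where X: "A = range X"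
    using range_from_nat_into[OF A(2,3)] by metis
  then have XC: "X n \<in> \<C>" for n using A(1) by auto
  \<comment> \<open>Cutting at the upper bound changes nothing quasi surely and makes the countable
    supremum finite at every point.\<close>
  define f where "f n \<omega> = min (rep (X n) \<omega>) (rep U \<omega>)" for n \<omega>
  have f: "f n \<in> FC" for n unfolding f_def by (intro fn_min rep_fn XC U)
  note [measurable] = fn_measurable[OF f]
  have f_eq: "\<forall>\<^sub>F \<omega> in qs. \<forall>n. f n \<omega> = rep (X n) \<omega>"
  proof (subst eventually_quasi_surely_all, rule allI)
    fix n
    have "\<forall>\<^sub>F \<omega> in qs. rep (X n) \<omega> \<le> rep U \<omega>" using U XC X by (auto simp flip: qs_le_rep)
    then show "\<forall>\<^sub>F \<omega> in qs. f n \<omega> = rep (X n) \<omega>" by eventually_elim (simp add: f_def)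
  qed
  have bdd: "bdd_above (range (\<lambda>n. f n \<omega>))" for \<omega>
    by (rule bdd_aboveI[of _ "rep U \<omega>"]) (auto simp: f_def)
  define s where "s \<omega> = (SUP n. f n \<omega>)" for \<omega>
  have s_m: "s \<in> borel_measurable M" unfolding s_def using bdd by (intro borel_measurable_cSUP) auto
  have upper: "f n \<omega> \<le> s \<omega>" for n \<omega> unfolding s_def by (intro cSUP_upper bdd) auto
  have le_U: "s \<omega> \<le> rep U \<omega>" for \<omega> unfolding s_def by (intro cSUP_least) (auto simp: f_def)
  have s: "s \<in> FC"
  proof (rule ideal_fn[OF ideal s_m])
    \<comment> \<open>The supremum lies between \<open>f 0\<close> and \<open>rep U\<close>, so this
      sum dominates it in absolute value.\<close>
    show "(\<lambda>\<omega>. \<bar>f 0 \<omega>\<bar> + \<bar>rep U \<omega>\<bar>) \<in> FC" by (intro fn_add fn_abs f rep_fn U)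
    show "\<forall>\<^sub>F \<omega> in qs. \<bar>s \<omega>\<bar> \<le> \<bar>\<bar>f 0 \<omega>\<bar> + \<bar>rep U \<omega>\<bar>\<bar>"
    proof (rule always_eventually, rule allI)
      fix \<omega>
      show "\<bar>s \<omega>\<bar> \<le> \<bar>\<bar>f 0 \<omega>\<bar> + \<bar>rep U \<omega>\<bar>\<bar>" using upper[of 0 \<omega>] le_U[of \<omega>] by linarith
    qed
  qed
  show "\<exists>S. is_lub (qs_order \<PP> \<C>) S A"
  proof (intro exI[of _ "cls s"], unfold is_lub_qs_order, intro conjI ballI impI)
    show "cls s \<in> \<C>" by (rule fn_cls[OF s])
    fix Y assume "Y \<in> A \<inter> \<C>"
    then obtain n where n: "Y = X n" using X by blast
    have "\<forall>\<^sub>F \<omega> in qs. rep (X n) \<omega> \<le> s \<omega>"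
      using f_eq by eventually_elim (metis upper)
    then show "qs_le \<PP> Y (cls s)"
      using qs_le_cls_fn[OF rep_fn[OF XC] s] by (simp add: n cls_rep[OF XC])
  next
    fix V assume V: "V \<in> \<C>" and le: "\<forall>Y\<in>A \<inter> \<C>. qs_le \<PP> Y V"
    have "\<forall>\<^sub>F \<omega> in qs. rep (X n) \<omega> \<le> rep V \<omega>" for n
      using le X XC V by (auto simp flip: qs_le_rep)
    then have "\<forall>\<^sub>F \<omega> in qs. \<forall>n. rep (X n) \<omega> \<le> rep V \<omega>" by (simp add: eventually_quasi_surely_all)
    with f_eq have "\<forall>\<^sub>F \<omega> in qs. s \<omega> \<le> rep V \<omega>"
    proof eventually_elim
      fix \<omega> assume "\<forall>n. f n \<omega> = rep (X n) \<omega>" "\<forall>n. rep (X n) \<omega> \<le> rep V \<omega>"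
      then show "s \<omega> \<le> rep V \<omega>" unfolding s_def by (intro cSUP_least) auto
    qed
    then show "qs_le \<PP> (cls s) V"
      using qs_le_cls_fn[OF s rep_fn[OF V]] by (simp add: cls_rep[OF V])
  qed
qed

lemma sigma_order_continuous_if_ideal:
  assumes ideal: "lattice_ideal M \<PP> (LPhi M \<PP> \<Phi>) \<C>"
    and \<mu>: "\<mu> \<in> ca_dom M \<PP>" and int: "\<forall>X\<in>\<C>. abs_integrable M \<mu> X"
  shows "sigma_order_continuous M \<PP> \<C> (signed_integral M \<mu>)"
  unfolding sigma_order_continuous_def
proof (intro conjI ballI allI impI)
  let ?N = "abs_measure M \<mu>"
  have ca: "\<mu> \<in> ca M" using \<mu> by (simp add: ca_dom_def)
  have int_fn: "integrable ?N f" if "f \<in> FC" for f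
    using integrable_abs_measure[OF \<mu> _ that] int by blast
  have le: "\<bar>signed_integral M \<mu> Z\<bar> \<le> 2 * (\<integral>\<omega>. \<bar>rep Z \<omega>\<bar> \<partial>?N)" if "Z \<in> \<C>" for Z
    using abs_signed_integral_le[OF ca] int that by blast
  note AE = AE_qs_continuous[OF qs_continuous_abs_measure[OF \<mu>]]
  {
    fix X Y assume X: "X \<in> \<C>" and Y: "Y \<in> \<C>"
    show "bounded (signed_integral M \<mu> ` {Z \<in> \<C>. qs_le \<PP> X Z \<and> qs_le \<PP> Z Y})"
      unfolding bounded_iff
    proof (intro exI ballI, elim imageE CollectE conjE)
      fix v Z assume v: "v = signed_integral M \<mu> Z" and Z: "Z \<in> \<C>" and XZ: "qs_le \<PP> X Z" and ZY: "qs_le \<PP> Z Y"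
      note [measurable] = fn_measurable[OF rep_fn[OF X]] fn_measurable[OF rep_fn[OF Y]] fn_measurable[OF rep_fn[OF Z]]
      have "(\<integral>\<omega>. \<bar>rep Z \<omega>\<bar> \<partial>?N) \<le> (\<integral>\<omega>. \<bar>rep X \<omega>\<bar> + \<bar>rep Y \<omega>\<bar> \<partial>?N)"
      proof (intro integral_mono_AE int_fn fn_add fn_abs rep_fn X Y Z AE)
        have "\<forall>\<^sub>F \<omega> in qs. rep X \<omega> \<le> rep Z \<omega>" "\<forall>\<^sub>F \<omega> in qs. rep Z \<omega> \<le> rep Y \<omega>"
          using XZ ZY X Y Z by (auto simp: qs_le_rep)
        then show "\<forall>\<^sub>F \<omega> in qs. \<bar>rep Z \<omega>\<bar> \<le> \<bar>rep X \<omega>\<bar> + \<bar>rep Y \<omega>\<bar>"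
          by eventually_elim linarith
      qed measurable
      then show "norm v \<le> 2 * (\<integral>\<omega>. \<bar>rep X \<omega>\<bar> + \<bar>rep Y \<omega>\<bar> \<partial>?N)"
        using le[OF Z] by (simp add: v)
    qed
  }
  fix X Y :: "nat \<Rightarrow> ('a \<Rightarrow> real) set"
  assume "range X \<subseteq> \<C> \<and> range Y \<subseteq> {Z \<in> \<C>. qs_le \<PP> (qs_zero M \<PP>) Z} \<and>
    (\<forall>n. qs_le \<PP> (qs_abs M \<PP> (X n)) (Y n)) \<and> (\<forall>n. qs_le \<PP> (Y (Suc n)) (Y n)) \<and>
    is_glb (qs_order \<PP> \<C>) (qs_zero M \<PP>) (range Y)"
  then have X: "X n \<in> \<C>" and Y: "Y n \<in> \<C>" and Y0: "qs_le \<PP> (qs_zero M \<PP>) (Y n)"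
    and XY: "qs_le \<PP> (qs_abs M \<PP> (X n)) (Y n)" and dec: "qs_le \<PP> (Y (Suc n)) (Y n)"
    and glb: "is_glb (qs_order \<PP> \<C>) (qs_zero M \<PP>) (range Y)" for n
    by auto
  define y where "y n = rep (Y n)" for n
  have y: "y n \<in> FC" and cls_y: "cls (y n) = Y n" for n unfolding y_def using Y rep_fn cls_rep by auto
  note [measurable] = fn_measurable[OF y] fn_measurable[OF rep_fn[OF X]]
  have y0: "\<forall>\<^sub>F \<omega> in qs. 0 \<le> y n \<omega>" for n
    using Y0[of n] qs_le_cls_fn[OF fn_zero y, of n] by (simp add: qs_zero_def cls_y)
  have y_dec: "\<forall>\<^sub>F \<omega> in qs. y (Suc n) \<omega> \<le> y n \<omega>" for n
    using dec[of n] qs_le_cls_fn[OF y y] by (metis cls_y)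
  have X_le: "\<forall>\<^sub>F \<omega> in qs. \<bar>rep (X n) \<omega>\<bar> \<le> y n \<omega>" for n
    using XY[of n] qs_le_cls_fn[OF fn_abs[OF rep_fn[OF X]] y, of n n] by (simp add: qs_abs_def cls_y)
  \<comment> \<open>The pointwise infimum becomes a competitor for the infimum in \<C>: since
    \<open>0 \<le> i \<le> \<bar>y 0\<bar>\<close> it lies in the ideal, and the hypothesis on
    \<open>Y\<close> forces \<open>i \<le> 0\<close> quasi surely. The \<open>max 0\<close> provides
    a lower bound at every point.\<close>
  define i where "i \<omega> = (INF n. max 0 (y n \<omega>))" for \<omega>
  have bdd: "bdd_below (range (\<lambda>n. max 0 (y n \<omega>)))" for \<omega> by (rule bdd_belowI[of _ 0]) auto
  have i_m: "i \<in> borel_measurable M" unfolding i_def using bdd by (intro borel_measurable_cINF) auto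
  have i0: "0 \<le> i \<omega>" for \<omega> unfolding i_def by (intro cINF_greatest) auto
  have i_le: "i \<omega> \<le> max 0 (y n \<omega>)" for \<omega> n unfolding i_def by (intro cINF_lower bdd) auto
  have i: "i \<in> FC"
  proof (rule ideal_fn[OF ideal i_m y[of 0]])
    show "\<forall>\<^sub>F \<omega> in qs. \<bar>i \<omega>\<bar> \<le> \<bar>y 0 \<omega>\<bar>"
    proof (rule always_eventually, rule allI)
      fix \<omega> show "\<bar>i \<omega>\<bar> \<le> \<bar>y 0 \<omega>\<bar>" using i0[of \<omega>] i_le[of \<omega> 0] by linarith
    qed
  qed
  have "qs_le \<PP> (cls i) (Y n)" for n
  proof -
    have "\<forall>\<^sub>F \<omega> in qs. i \<omega> \<le> y n \<omega>" using y0[of n] by eventually_elim (metis i_le max.absorb2)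
    then show ?thesis using qs_le_cls_fn[OF i y] cls_y by metis
  qed
  then have "qs_le \<PP> (cls i) (qs_zero M \<PP>)"
    using glb fn_cls[OF i] unfolding is_glb_qs_order by blast
  then have "\<forall>\<^sub>F \<omega> in qs. i \<omega> \<le> 0" using qs_le_cls_fn[OF i fn_zero] by (simp add: qs_zero_def)
  moreover have "\<forall>\<^sub>F \<omega> in qs. \<forall>n. 0 \<le> y n \<omega>" "\<forall>\<^sub>F \<omega> in qs. \<forall>n. y (Suc n) \<omega> \<le> y n \<omega>"
    using y0 y_dec by (auto simp: eventually_quasi_surely_all)
  ultimately have lim: "\<forall>\<^sub>F \<omega> in qs. (\<lambda>n. y n \<omega>) \<longlonglongrightarrow> 0"
  proof eventually_elim
    fix \<omega> assume *: "i \<omega> \<le> 0" "\<forall>n. 0 \<le> y n \<omega>" "\<forall>n. y (Suc n) \<omega> \<le> y n \<omega>"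
    then have eq: "max 0 (y n \<omega>) = y n \<omega>" for n by simp
    have "decseq (\<lambda>n. y n \<omega>)" using * by (intro decseq_SucI) auto
    moreover have "bdd_below (range (\<lambda>n. y n \<omega>))" using bdd[of \<omega>] by (simp add: eq)
    ultimately have "(\<lambda>n. y n \<omega>) \<longlonglongrightarrow> (INF n. y n \<omega>)" by (intro LIMSEQ_decseq_INF)
    moreover have "(INF n. y n \<omega>) = 0" using *(1) i0[of \<omega>] by (simp add: i_def eq)
    ultimately show "(\<lambda>n. y n \<omega>) \<longlonglongrightarrow> 0" by simp
  qed
  have "\<forall>\<^sub>F \<omega> in qs. \<bar>y n \<omega>\<bar> \<le> y 0 \<omega>" for n
    using \<open>\<forall>\<^sub>F \<omega> in qs. \<forall>n. 0 \<le> y n \<omega>\<close> \<open>\<forall>\<^sub>F \<omega> in qs. \<forall>n. y (Suc n) \<omega> \<le> y n \<omega>\<close>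
  proof eventually_elim
    fix \<omega> assume *: "\<forall>n. 0 \<le> y n \<omega>" "\<forall>n. y (Suc n) \<omega> \<le> y n \<omega>"
    then have "decseq (\<lambda>n. y n \<omega>)" by (intro decseq_SucI) auto
    then have "y n \<omega> \<le> y 0 \<omega>" by (rule decseqD) simp
    with * show "\<bar>y n \<omega>\<bar> \<le> y 0 \<omega>" by simp
  qed
  note dom = this
  have m_N: "f \<in> borel_measurable ?N" if "f \<in> FC" for f using int_fn[OF that] by simp
  have "(\<lambda>n. \<integral>\<omega>. y n \<omega> \<partial>?N) \<longlonglongrightarrow> (\<integral>\<omega>. 0 \<partial>?N)"
  proof (rule integral_dominated_convergence[where w = "y 0"])
    show "AE \<omega> in ?N. (\<lambda>n. y n \<omega>) \<longlonglongrightarrow> 0" by (rule AE[OF _ lim]) measurable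
    show "AE \<omega> in ?N. norm (y n \<omega>) \<le> y 0 \<omega>" for n
      unfolding real_norm_def by (rule AE[OF _ dom]) measurable
  qed (auto intro: m_N int_fn y)
  then have lim2: "(\<lambda>n. 2 * (\<integral>\<omega>. y n \<omega> \<partial>?N)) \<longlonglongrightarrow> 0" by (auto intro: tendsto_mult_right_zero)
  have bound: "\<bar>signed_integral M \<mu> (X n)\<bar> \<le> 2 * (\<integral>\<omega>. y n \<omega> \<partial>?N)" for n
  proof -
    have "(\<integral>\<omega>. \<bar>rep (X n) \<omega>\<bar> \<partial>?N) \<le> (\<integral>\<omega>. y n \<omega> \<partial>?N)"
      by (intro integral_mono_AE int_fn fn_abs rep_fn X y AE[OF _ X_le]) measurable
    with le[OF X, of n] show ?thesis by linarith
  qed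
  show "(\<lambda>n. \<bar>signed_integral M \<mu> (X n)\<bar>) \<longlonglongrightarrow> 0"
    by (rule Lim_null_comparison[OF always_eventually lim2]) (simp add: bound)
qed

lemma ca_cont_eq_ca_sigma_if_ideal:
  assumes ideal: "lattice_ideal M \<PP> (LPhi M \<PP> \<Phi>) \<C>"
  shows "ca_cont M \<PP> \<Phi> \<C> = ca_sigma M \<PP> \<C>"
  unfolding ca_cont_eq ca_sigma_def using sigma_order_continuous_if_ideal[OF ideal] by blast

section \<open>From order limits in \<C> to pointwise limits\<close>

lemma sigma_complete_lub:
  assumes "dedekind_sigma_complete \<PP> \<C>" and f: "\<And>n::nat. f n \<in> FC" and u: "u \<in> FC"
    and le: "\<And>n. \<forall>\<^sub>F \<omega> in qs. f n \<omega> \<le> u \<omega>"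
  shows "\<exists>s\<in>FC. (\<forall>n. \<forall>\<^sub>F \<omega> in qs. f n \<omega> \<le> s \<omega>) \<and>
    (\<forall>v\<in>FC. (\<forall>n. \<forall>\<^sub>F \<omega> in qs. f n \<omega> \<le> v \<omega>) \<longrightarrow> (\<forall>\<^sub>F \<omega> in qs. s \<omega> \<le> v \<omega>))"
proof -
  define A where "A = range (\<lambda>n. cls (f n))"
  have A: "A \<subseteq> \<C>" using f fn_cls by (auto simp: A_def)
  have u_A: "cls u \<in> Upper (qs_order \<PP> \<C>) A"
    using le f u fn_cls by (auto simp: Upper_qs_order A_def qs_le_cls_fn)
  have "\<exists>S. is_lub (qs_order \<PP> \<C>) S A"
    by (rule assms(1)[unfolded dedekind_sigma_complete_def, rule_format]) (use A u_A in \<open>auto simp: A_def\<close>)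
  then obtain S where S: "is_lub (qs_order \<PP> \<C>) S A" ..
  then have SC: "S \<in> \<C>" by (simp add: is_lub_qs_order)
  show ?thesis
  proof (intro bexI[of _ "rep S"] conjI allI ballI impI rep_fn SC)
    show "\<forall>\<^sub>F \<omega> in qs. f n \<omega> \<le> rep S \<omega>" for n
      using S qs_le_cls_fn[OF f rep_fn[OF SC], of n] fn_cls[OF f] by (auto simp: is_lub_qs_order A_def cls_rep[OF SC])
    fix v assume v: "v \<in> FC" and "\<forall>n. \<forall>\<^sub>F \<omega> in qs. f n \<omega> \<le> v \<omega>"
    then have "qs_le \<PP> S (cls v)"
      using S fn_cls[OF v] qs_le_cls_fn[OF f v] by (auto simp: is_lub_qs_order A_def)
    then show "\<forall>\<^sub>F \<omega> in qs. rep S \<omega> \<le> v \<omega>"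
      using qs_le_cls_fn[OF rep_fn[OF SC] v] by (simp add: cls_rep[OF SC])
  qed
qed

text \<open>The sequence serves as its own majorant in the definition of order continuity. For
  positive \<open>\<mu>\<close> the signed integral is the integral against
  \<open>abs_measure\<close>.\<close>

lemma ca_sigma_plus_tendsto_0:
  assumes \<mu>: "\<mu> \<in> ca_sigma_plus M \<PP> \<C>" and y: "\<And>n. y n \<in> FC"
    and nonneg: "\<And>n. \<forall>\<^sub>F \<omega> in qs. 0 \<le> y n \<omega>" and dec: "\<And>n. \<forall>\<^sub>F \<omega> in qs. y (Suc n) \<omega> \<le> y n \<omega>"
    and glb: "\<And>v. v \<in> FC \<Longrightarrow> (\<And>n. \<forall>\<^sub>F \<omega> in qs. v \<omega> \<le> y n \<omega>) \<Longrightarrow> \<forall>\<^sub>F \<omega> in qs. v \<omega> \<le> 0"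
  shows "(\<lambda>n. \<integral>\<omega>. y n \<omega> \<partial>abs_measure M \<mu>) \<longlonglongrightarrow> 0"
proof -
  have plus: "\<mu> \<in> ca_plus M" and dom: "\<mu> \<in> ca_dom M \<PP>" and int: "\<forall>X\<in>\<C>. abs_integrable M \<mu> X"
    and cont: "sigma_order_continuous M \<PP> \<C> (signed_integral M \<mu>)"
    using \<mu> by (auto simp: ca_sigma_plus_def ca_sigma_def)
  let ?Y = "\<lambda>n. cls (y n)"
  have "range ?Y \<subseteq> \<C>" using fn_cls[OF y] by auto
  moreover have "range ?Y \<subseteq> {Z \<in> \<C>. qs_le \<PP> (qs_zero M \<PP>) Z}"
    using fn_cls[OF y] nonneg qs_le_cls_fn[OF fn_zero y] by (auto simp: qs_zero_def)
  moreover have "qs_le \<PP> (qs_abs M \<PP> (?Y n)) (?Y n)" for n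
  proof -
    have "\<forall>\<^sub>F \<omega> in qs. \<bar>y n \<omega>\<bar> \<le> y n \<omega>" using nonneg[of n] by eventually_elim simp
    then show ?thesis
      using qs_abs_cls[OF fn_measurable[OF y[of n]] fn_measurable[OF y[of n]]] qs_le_cls_fn[OF fn_abs[OF y] y] by simp
  qed
  moreover have "qs_le \<PP> (?Y (Suc n)) (?Y n)" for n using dec qs_le_cls_fn[OF y y] by blast
  moreover have "is_glb (qs_order \<PP> \<C>) (qs_zero M \<PP>) (range ?Y)"
    unfolding is_glb_qs_order
  proof (intro conjI ballI impI)
    show "qs_zero M \<PP> \<in> \<C>" unfolding qs_zero_def by (rule fn_cls[OF fn_zero])
    show "qs_le \<PP> (qs_zero M \<PP>) X" if "X \<in> range ?Y \<inter> \<C>" for X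
      using that nonneg qs_le_cls_fn[OF fn_zero y] by (auto simp: qs_zero_def)
    fix V assume V: "V \<in> \<C>" and le: "\<forall>X\<in>range ?Y \<inter> \<C>. qs_le \<PP> V X"
    have "\<forall>\<^sub>F \<omega> in qs. rep V \<omega> \<le> y n \<omega>" for n
      using le fn_cls[OF y] qs_le_cls_fn[OF rep_fn[OF V] y, of n] by (auto simp: cls_rep[OF V])
    then have "\<forall>\<^sub>F \<omega> in qs. rep V \<omega> \<le> 0" by (intro glb rep_fn V)
    then show "qs_le \<PP> V (qs_zero M \<PP>)"
      using qs_le_cls_fn[OF rep_fn[OF V] fn_zero] by (simp add: qs_zero_def cls_rep[OF V])
  qed
  ultimately have "(\<lambda>n. \<bar>signed_integral M \<mu> (?Y n)\<bar>) \<longlonglongrightarrow> 0"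
    using cont[unfolded sigma_order_continuous_def, THEN conjunct2, rule_format, of ?Y ?Y] by blast
  moreover have "signed_integral M \<mu> (?Y n) = (\<integral>\<omega>. y n \<omega> \<partial>abs_measure M \<mu>)" for n
    using abs_integral_cls[OF dom _ y] int by (simp add: signed_integral_ca_plus[OF plus])
  ultimately show ?thesis by (simp add: tendsto_rabs_zero_iff)
qed

text \<open>The order limit in \<open>\<C>\<close> may a priori be larger than the pointwise one; the measures in
  \<open>ca_sigma_plus\<close> do not see the difference, and they determine the polar sets.\<close>

lemma fn_monotone_limit:
  assumes dsc: "dedekind_sigma_complete \<PP> \<C>"
    and dom: "dominated M (measure ` \<PP>) (ca_sigma_plus M \<PP> \<C>)"
    and f: "\<And>n::nat. f n \<in> FC" and inc: "\<And>n. \<forall>\<^sub>F \<omega> in qs. f n \<omega> \<le> f (Suc n) \<omega>"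
    and lim: "\<forall>\<^sub>F \<omega> in qs. (\<lambda>n. f n \<omega>) \<longlonglongrightarrow> g \<omega>"
    and g: "g \<in> borel_measurable M" and u: "u \<in> FC" "\<forall>\<^sub>F \<omega> in qs. g \<omega> \<le> u \<omega>"
  shows "g \<in> FC"
proof -
  have "\<forall>\<^sub>F \<omega> in qs. \<forall>n. f n \<omega> \<le> f (Suc n) \<omega>" using inc by (simp add: eventually_quasi_surely_all)
  with lim have "\<forall>\<^sub>F \<omega> in qs. \<forall>n. f n \<omega> \<le> g \<omega>"
    by eventually_elim (metis incseq_SucI incseq_le)
  then have f_le: "\<forall>\<^sub>F \<omega> in qs. f n \<omega> \<le> g \<omega>" for n by eventually_elim simp
  have f_le_u: "\<forall>\<^sub>F \<omega> in qs. f n \<omega> \<le> u \<omega>" for n using f_le[of n] u(2) by eventually_elim simp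
  obtain s where s_fn: "s \<in> FC" and lub: "(\<forall>n. \<forall>\<^sub>F \<omega> in qs. f n \<omega> \<le> s \<omega>) \<and>
      (\<forall>v\<in>FC. (\<forall>n. \<forall>\<^sub>F \<omega> in qs. f n \<omega> \<le> v \<omega>) \<longrightarrow> (\<forall>\<^sub>F \<omega> in qs. s \<omega> \<le> v \<omega>))"
    by (rule bexE[OF sigma_complete_lub[OF dsc f u(1) f_le_u]])
  have s: "s \<in> FC" "\<And>n. \<forall>\<^sub>F \<omega> in qs. f n \<omega> \<le> s \<omega>"
    and least: "\<And>v. v \<in> FC \<Longrightarrow> (\<And>n. \<forall>\<^sub>F \<omega> in qs. f n \<omega> \<le> v \<omega>) \<Longrightarrow> \<forall>\<^sub>F \<omega> in qs. s \<omega> \<le> v \<omega>"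
    using s_fn lub by simp_all
  note [measurable] = fn_measurable[OF f] fn_measurable[OF s(1)] g
  have "\<forall>\<^sub>F \<omega> in qs. \<forall>n. f n \<omega> \<le> s \<omega>" using s(2) by (simp add: eventually_quasi_surely_all)
  with lim have g_le: "\<forall>\<^sub>F \<omega> in qs. g \<omega> \<le> s \<omega>"
    by eventually_elim (auto intro: LIMSEQ_le_const2)
  have y: "(\<lambda>\<omega>. s \<omega> - f n \<omega>) \<in> FC" for n by (intro fn_diff s f)
  have y0: "\<forall>\<^sub>F \<omega> in qs. 0 \<le> s \<omega> - f n \<omega>" for n using s(2)[of n] by eventually_elim simp
  have y_dec: "\<forall>\<^sub>F \<omega> in qs. s \<omega> - f (Suc n) \<omega> \<le> s \<omega> - f n \<omega>" for n
    using inc[of n] by eventually_elim simp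
  \<comment> \<open>A lower bound \<open>v\<close> of the differences \<open>s - f n\<close> makes
    \<open>s - v\<close> another upper bound of the \<open>f n\<close>, and leastness of
    \<open>s\<close> gives \<open>v \<le> 0\<close>.\<close>
  have glb: "\<forall>\<^sub>F \<omega> in qs. v \<omega> \<le> 0" if v: "v \<in> FC" "\<And>n. \<forall>\<^sub>F \<omega> in qs. v \<omega> \<le> s \<omega> - f n \<omega>" for v
  proof -
    have "\<forall>\<^sub>F \<omega> in qs. f n \<omega> \<le> s \<omega> - v \<omega>" for n using v(2)[of n] by eventually_elim simp
    then have "\<forall>\<^sub>F \<omega> in qs. s \<omega> \<le> s \<omega> - v \<omega>" by (intro least fn_diff s v)
    then show ?thesis by eventually_elim simp
  qed
  define D where "D = {\<omega> \<in> space M. s \<omega> \<noteq> g \<omega>}"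
  have D: "D \<in> sets M" unfolding D_def by measurable
  have "total_variation M \<mu> D = 0" if \<mu>: "\<mu> \<in> ca_sigma_plus M \<PP> \<C>" for \<mu>
  proof -
    let ?N = "abs_measure M \<mu>"
    have dom: "\<mu> \<in> ca_dom M \<PP>" and int: "\<forall>X\<in>\<C>. abs_integrable M \<mu> X" and ca: "\<mu> \<in> ca M"
      using \<mu> by (auto simp: ca_sigma_plus_def ca_sigma_def ca_dom_def)
    note AE = AE_qs_continuous[OF qs_continuous_abs_measure[OF dom]]
    have lim0: "(\<lambda>n. \<integral>\<omega>. s \<omega> - f n \<omega> \<partial>?N) \<longlonglongrightarrow> 0"
      by (rule ca_sigma_plus_tendsto_0[where y = "\<lambda>n \<omega>. s \<omega> - f n \<omega>", OF \<mu> y y0 y_dec glb])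
    have int_y: "integrable ?N (\<lambda>\<omega>. s \<omega> - f n \<omega>)" for n
      using integrable_abs_measure[OF dom _ y] int by blast
    have "\<forall>\<^sub>F \<omega> in qs. 0 \<le> s \<omega> - g \<omega>" using g_le by eventually_elim simp
    then have AE_nonneg: "AE \<omega> in ?N. 0 \<le> s \<omega> - g \<omega>" by (intro AE) measurable
    have AE_le: "AE \<omega> in ?N. s \<omega> - g \<omega> \<le> s \<omega> - f n \<omega>" for n
    proof (rule AE)
      show "\<forall>\<^sub>F \<omega> in qs. s \<omega> - g \<omega> \<le> s \<omega> - f n \<omega>" using f_le[of n] by eventually_elim simp
    qed measurable
    have "(\<lambda>\<omega>. s \<omega> - g \<omega>) \<in> borel_measurable M" by measurable
    then have m: "(\<lambda>\<omega>. s \<omega> - g \<omega>) \<in> borel_measurable ?N"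
      using measurable_cong_sets[OF sets_abs_measure refl] by blast
    \<comment> \<open>Membership of \<open>g\<close> in \<C> is still open, so integrability comes
      from \<open>0 \<le> s - g \<le> s - f 0\<close> almost everywhere.\<close>
    have int_d: "integrable ?N (\<lambda>\<omega>. s \<omega> - g \<omega>)"
    proof (rule Bochner_Integration.integrable_bound[OF int_y[of 0] m])
      show "AE \<omega> in ?N. norm (s \<omega> - g \<omega>) \<le> norm (s \<omega> - f 0 \<omega>)"
        using AE_nonneg AE_le[of 0] by eventually_elim simp
    qed
    have "(\<integral>\<omega>. s \<omega> - g \<omega> \<partial>?N) \<le> 0"
      using lim0 by (rule LIMSEQ_le_const) (auto intro!: integral_mono_AE int_d int_y AE_le)
    moreover have "0 \<le> (\<integral>\<omega>. s \<omega> - g \<omega> \<partial>?N)" by (rule integral_nonneg_AE[OF AE_nonneg])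
    ultimately have "(\<integral>\<omega>. s \<omega> - g \<omega> \<partial>?N) = 0" by simp
    then have "AE \<omega> in ?N. s \<omega> - g \<omega> = 0"
      using integral_nonneg_eq_0_iff_AE[OF int_d AE_nonneg] by simp
    then have "AE \<omega> in ?N. \<omega> \<notin> D" by eventually_elim (simp add: D_def)
    then have "emeasure ?N D = 0" using D AE_iff_null_sets[of D ?N] by auto
    then show ?thesis using emeasure_abs_measure[OF ca_signed_additive[OF ca] D] by simp
  qed
  then have "(SUP \<mu>\<in>ca_sigma_plus M \<PP> \<C>. total_variation M \<mu> D) = 0"
    unfolding bot_ennreal[symmetric] SUP_bot_conv by simp
  \<comment> \<open>Domination enters here: a set that is null for all positive order continuous
    measures is polar.\<close>
  then have "(SUP \<mu>\<in>measure ` \<PP>. total_variation M \<mu> D) = 0"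
    using dom D unfolding dominated_def by blast
  then have "\<forall>\<^sub>F \<omega> in qs. \<omega> \<notin> D"
    by (simp only: measure_image_SUP_eq_0_iff[OF D] emeasure_eq_0_iff_qs[OF D])
  with eventually_qs_space have "\<forall>\<^sub>F \<omega> in qs. s \<omega> = g \<omega>"
    by eventually_elim (simp add: D_def)
  with fn_cong[OF s(1) g] show ?thesis by blast
qed

lemma indicator_in_fn:
  assumes dsc: "dedekind_sigma_complete \<PP> \<C>"
    and dom: "dominated M (measure ` \<PP>) (ca_sigma_plus M \<PP> \<C>)"
    and gen: "generates M \<PP> \<H>" and H: "fn M \<PP> \<H> \<subseteq> FC" and A: "A \<in> sets M"
  shows "(indicator A :: 'a \<Rightarrow> real) \<in> FC"
proof -
  define \<S> where "\<S> = {A \<in> sets M. (indicator A :: 'a \<Rightarrow> real) \<in> FC}"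
  \<comment> \<open>For indicators the constant 1 is the upper bound in \<C> that monotone limits
    require.\<close>
  note lim = fn_monotone_limit[OF dsc dom _ _ _ _ fn_one]
  have "sigma_algebra (space M) \<S>"
    unfolding sigma_algebra_iff2
  proof (intro conjI ballI allI impI)
    show "\<S> \<subseteq> Pow (space M)" using sets.space_closed by (auto simp: \<S>_def)
    have "(indicator {} :: 'a \<Rightarrow> real) = (\<lambda>_. 0)" by (simp add: fun_eq_iff)
    then show "{} \<in> \<S>" using fn_zero by (simp only: \<S>_def mem_Collect_eq sets.empty_sets simp_thms)
    show "space M - A \<in> \<S>" if "A \<in> \<S>" for A
    proof -
      have A: "A \<in> sets M" "(indicator A :: 'a \<Rightarrow> real) \<in> FC" using that by (auto simp: \<S>_def)
      have "(\<lambda>\<omega>. 1 - indicator A \<omega> :: real) \<in> FC" by (intro fn_diff fn_one A)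
      moreover have "\<forall>\<^sub>F \<omega> in qs. 1 - indicator A \<omega> = (indicator (space M - A) \<omega> :: real)"
        using eventually_qs_space by eventually_elim (simp add: indicator_def)
      ultimately have "(indicator (space M - A) :: 'a \<Rightarrow> real) \<in> FC"
        using A(1) by (intro fn_cong[where g = "indicator (space M - A)"]) auto
      then show ?thesis using A by (simp add: \<S>_def)
    qed
    show "\<Union> (range A) \<in> \<S>" if "range A \<subseteq> \<S>" for A :: "nat \<Rightarrow> 'a set"
    proof -
      have A: "A n \<in> sets M" "(indicator (A n) :: 'a \<Rightarrow> real) \<in> FC" for n using that by (auto simp: \<S>_def)
      have "(indicator (\<Union>i<n. A i) :: 'a \<Rightarrow> real) \<in> FC" for n
      proof (induction n)
        case 0
        have "(indicator {} :: 'a \<Rightarrow> real) = (\<lambda>_. 0)" by (simp add: fun_eq_iff)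
        then show ?case using fn_zero by (simp only: lessThan_0 UN_empty)
      next
        case (Suc n)
        have "(\<lambda>\<omega>. max (indicator (\<Union>i<n. A i) \<omega>) (indicator (A n) \<omega>) :: real) \<in> FC"
          by (intro fn_max Suc A)
        moreover have "(\<lambda>\<omega>. max (indicator (\<Union>i<n. A i) \<omega>) (indicator (A n) \<omega>) :: real) = indicator (\<Union>i<Suc n. A i)"
          by (auto simp: fun_eq_iff indicator_def less_Suc_eq max_def)
        ultimately show ?case by simp
      qed
      note partial = this
      have UN: "(\<Union>i. A i) \<in> sets M" using A by auto
      have "(indicator (\<Union>i. A i) :: 'a \<Rightarrow> real) \<in> FC"
      proof (rule lim[where f = "\<lambda>n. indicator (\<Union>i<n. A i)", OF partial])
        show "\<forall>\<^sub>F \<omega> in qs. indicator (\<Union>i<n. A i) \<omega> \<le> (indicator (\<Union>i<Suc n. A i) \<omega> :: real)" for n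
          by (intro always_eventually allI) (auto simp: indicator_def less_Suc_eq)
        show "\<forall>\<^sub>F \<omega> in qs. (\<lambda>n. indicator (\<Union>i<n. A i) \<omega> :: real) \<longlonglongrightarrow> indicator (\<Union>i. A i) \<omega>"
          by (intro always_eventually allI LIMSEQ_indicator_UN)
        show "\<forall>\<^sub>F \<omega> in qs. indicator (\<Union>i. A i) \<omega> \<le> (1 :: real)"
          by (intro always_eventually allI) (simp add: indicator_le_1)
      qed (use UN in simp)
      then show ?thesis using UN by (simp add: \<S>_def)
    qed
  qed
  then interpret S: sigma_algebra "space M" \<S> .
  \<comment> \<open>The zero measure is a placeholder: \<open>N\<close> carries the \<sigma>-algebra
    \<S>, so that measurability with respect to \<S> can be expressed.\<close>
  define N where "N = measure_of (space M) \<S> (\<lambda>_. 0)"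
  have N: "sets N = \<S>" "space N = space M"
    unfolding N_def using S.space_closed S.sigma_sets_eq by (auto simp: space_measure_of_conv)
  have fN: "f \<in> borel_measurable N" if f: "f \<in> FC" for f
    unfolding borel_measurable_iff_greater N
  proof
    fix a :: real
    note [measurable] = fn_measurable[OF f]
    have A: "{\<omega> \<in> space M. a < f \<omega>} \<in> sets M" by measurable
    \<comment> \<open>Truncated multiples of the excess of \<open>f\<close> over \<open>a\<close>
      increase to the indicator of \<open>{f > a}\<close> and use lattice operations and the
      constant 1 only. The form \<open>a * 1\<close> lets \<open>fn_scale\<close> produce the
      constant \<open>a\<close>.\<close>
    let ?h = "\<lambda>n::nat. \<lambda>\<omega>. min 1 (real n * max 0 (f \<omega> - a * 1))"
    have "(indicator {\<omega> \<in> space M. a < f \<omega>} :: 'a \<Rightarrow> real) \<in> FC"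
    proof (rule lim[where f = ?h])
      show "?h n \<in> FC" for n
        by (intro fn_min fn_one fn_scale fn_max fn_zero fn_diff f)
      show "\<forall>\<^sub>F \<omega> in qs. ?h n \<omega> \<le> ?h (Suc n) \<omega>" for n
        by (intro always_eventually allI min.mono mult_right_mono) auto
      show "\<forall>\<^sub>F \<omega> in qs. (\<lambda>n. ?h n \<omega>) \<longlonglongrightarrow> indicator {\<omega> \<in> space M. a < f \<omega>} \<omega>"
        using eventually_qs_space
      proof eventually_elim
        fix \<omega> assume \<omega>: "\<omega> \<in> space M"
        show "(\<lambda>n. ?h n \<omega>) \<longlonglongrightarrow> indicator {\<omega> \<in> space M. a < f \<omega>} \<omega>"
        proof (cases "a < f \<omega>")
          case True
          then obtain m :: nat where m: "1 < real m * (f \<omega> - a)" using reals_Archimedean3[of "f \<omega> - a"] by auto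
          have "eventually (\<lambda>n. ?h n \<omega> = 1) sequentially"
            using eventually_ge_at_top[of m]
          proof eventually_elim
            fix n assume "m \<le> n"
            then have "real m * (f \<omega> - a) \<le> real n * (f \<omega> - a)" using True by (intro mult_right_mono) auto
            with m have "1 \<le> real n * (f \<omega> - a)" by linarith
            with True show "?h n \<omega> = 1" by (simp add: max_def min_def)
          qed
          then show ?thesis using True \<omega> by (simp add: tendsto_eventually)
        qed (simp add: max_def)
      qed
    qed (use A in \<open>auto intro!: always_eventually simp: indicator_le_1\<close>)
    then show "{\<omega> \<in> space M. a < f \<omega>} \<in> \<S>" using A by (simp add: \<S>_def)
  qed
  have "A \<in> sigma_sets (space M)
      {f -` B \<inter> space M |f B. f \<in> borel_measurable M \<and> cls f \<in> \<H> \<and> B \<in> sets borel}"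
    using A gen by (simp add: generates_def)
  also have "\<dots> \<subseteq> \<S>"
  proof (rule S.sigma_sets_subset, safe)
    fix f :: "'a \<Rightarrow> real" and B :: "real set"
    assume "f \<in> borel_measurable M" "cls f \<in> \<H>" and B: "B \<in> sets borel"
    then have "f \<in> FC" using H by (auto simp: fn_def)
    from measurable_sets[OF fN[OF this] B] show "f -` B \<inter> space M \<in> \<S>" by (simp add: N)
  qed
  finally show ?thesis by (simp add: \<S>_def)
qed

lemma ideal_if_equivalent:
  assumes dsc: "dedekind_sigma_complete \<PP> \<C>"
    and dom: "dominated M (measure ` \<PP>) (ca_sigma_plus M \<PP> \<C>)"
    and gen: "generates M \<PP> \<H>" and H: "fn M \<PP> \<H> \<subseteq> FC"
    and f: "f \<in> borel_measurable M" and g: "g \<in> FC" and le: "\<forall>\<^sub>F \<omega> in qs. \<bar>f \<omega>\<bar> \<le> \<bar>g \<omega>\<bar>"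
  shows "f \<in> FC"
proof -
  \<comment> \<open>The bound \<open>u\<close> takes part in the induction, because monotone limits
    are known to stay in \<C> only below an element of \<C>. Each building block inherits it,
    rescaled in the case of a multiple.\<close>
  have nonneg: "h \<in> FC"
    if "h \<in> borel_measurable M" "\<And>\<omega>. 0 \<le> h \<omega>" "u \<in> FC" "\<forall>\<^sub>F \<omega> in qs. h \<omega> \<le> u \<omega>" for h u
    using that
  proof (induction arbitrary: u rule: borel_measurable_induct_real)
    case (set A)
    then show ?case by (intro indicator_in_fn[OF dsc dom gen H])
  next
    case (mult h c)
    show ?case
    proof (cases "c = 0")
      case False
      then have c: "0 < c" using mult by simp
      have "\<forall>\<^sub>F \<omega> in qs. h \<omega> \<le> 1 / c * u \<omega>"
        using mult.prems(2) by eventually_elim (use c in \<open>simp add: field_simps\<close>)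
      then show ?thesis using mult.IH[OF fn_scale[OF mult.prems(1)]] by (intro fn_scale)
    qed (simp add: fn_zero)
  next
    case (add h k)
    have "\<forall>\<^sub>F \<omega> in qs. h \<omega> \<le> u \<omega>" "\<forall>\<^sub>F \<omega> in qs. k \<omega> \<le> u \<omega>"
      using add.prems(2) by (eventually_elim, use add.hyps in \<open>smt (verit)\<close>)+
    then show ?case using add.IH add.prems(1) by (intro fn_add) auto
  next
    case (seq U u)
    show ?case
    proof (rule fn_monotone_limit[OF dsc dom, where f = U and u = u])
      have le: "U n \<omega> \<le> h \<omega>" if "\<omega> \<in> space M" for n \<omega>
        using seq that by (intro incseq_le) (auto simp: incseq_def le_fun_def)
      have "\<forall>\<^sub>F \<omega> in qs. U n \<omega> \<le> u \<omega>" for n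
        using seq.prems(2) eventually_qs_space by eventually_elim (metis le order_trans)
      then show "U n \<in> FC" for n using seq by blast
      show "\<forall>\<^sub>F \<omega> in qs. U n \<omega> \<le> U (Suc n) \<omega>" for n
        using seq by (auto simp: incseq_def le_fun_def intro!: always_eventually)
      show "\<forall>\<^sub>F \<omega> in qs. (\<lambda>n. U n \<omega>) \<longlonglongrightarrow> h \<omega>"
        using eventually_qs_space by eventually_elim (use seq in auto)
      show "h \<in> borel_measurable M"
        using seq by (intro borel_measurable_LIMSEQ_real[of M U h]) auto
    qed (use seq in auto)
  qed
  have "(\<lambda>\<omega>. max 0 (f \<omega>)) \<in> FC" "(\<lambda>\<omega>. max 0 (- f \<omega>)) \<in> FC"
    using f le by (auto intro!: nonneg[OF _ _ fn_abs[OF g]] elim!: eventually_mono)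
  then have "(\<lambda>\<omega>. max 0 (f \<omega>) - max 0 (- f \<omega>)) \<in> FC" by (rule fn_diff)
  moreover have "(\<lambda>\<omega>. max 0 (f \<omega>) - max 0 (- f \<omega>)) = f" by (auto simp: max_def)
  ultimately show ?thesis by simp
qed

end

section \<open>Bounded random variables\<close>

context robust_orlicz
begin

lemma vector_subspace_Linf:
  assumes "Linf M \<PP> \<subseteq> LPhi M \<PP> \<Phi>"
  shows "vector_subspace M \<PP> (LPhi M \<PP> \<Phi>) (Linf M \<PP>)"
  unfolding vector_subspace_def
proof (intro conjI ballI allI assms)
  show "qs_zero M \<PP> \<in> Linf M \<PP>"
    by (auto simp: qs_zero_def Linf_def intro!: exI[of _ "\<lambda>_. 0"] boundedI[of _ 0])
  show "qs_add M \<PP> X Y \<in> Linf M \<PP>" if X: "X \<in> Linf M \<PP>" and Y: "Y \<in> Linf M \<PP>" for X Y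
  proof -
    obtain f where f: "X = cls f" "f \<in> borel_measurable M" "bounded (f ` space M)"
      using X by (auto simp: Linf_def)
    obtain g where g: "Y = cls g" "g \<in> borel_measurable M" "bounded (g ` space M)"
      using Y by (auto simp: Linf_def)
    have "(\<lambda>\<omega>. f \<omega> + g \<omega>) \<in> borel_measurable M" using f g by measurable
    then show ?thesis
      using bounded_plus_comp[OF f(3) g(3)] f g unfolding Linf_def
      by (auto simp: qs_add_cls)
  qed
  show "qs_scale M \<PP> c X \<in> Linf M \<PP>" if X: "X \<in> Linf M \<PP>" for c X
  proof -
    obtain f where f: "X = cls f" "f \<in> borel_measurable M" "bounded (f ` space M)"
      using X by (auto simp: Linf_def)
    have "(\<lambda>\<omega>. c * f \<omega>) \<in> borel_measurable M" using f by measurable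
    then show ?thesis
      using bounded_scaling[OF f(3), of c] f unfolding Linf_def
      by (auto simp: qs_scale_cls[OF f(2) f(2)] image_image)
  qed
qed

lemma fn_Linf:
  assumes "f \<in> borel_measurable M" "\<And>\<omega>. \<omega> \<in> space M \<Longrightarrow> \<bar>f \<omega>\<bar> \<le> K"
  shows "f \<in> fn M \<PP> (Linf M \<PP>)"
  using assms by (auto simp: fn_def Linf_def intro!: exI[of _ f] boundedI[of _ K])

text \<open>A random variable whose class is in \<open>Linf\<close> may itself be unbounded on a
  polar set, so a bounded version has to be picked.\<close>

lemma fn_LinfE:
  assumes "f \<in> fn M \<PP> (Linf M \<PP>)"
  obtains g K where "g \<in> borel_measurable M" "\<And>\<omega>. \<omega> \<in> space M \<Longrightarrow> \<bar>g \<omega>\<bar> \<le> K" "\<forall>\<^sub>F \<omega> in qs. f \<omega> = g \<omega>"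
proof -
  obtain g where g: "cls f = cls g" "g \<in> borel_measurable M" "bounded (g ` space M)" and f: "f \<in> borel_measurable M"
    using assms by (auto simp: fn_def Linf_def)
  obtain K where "\<forall>x\<in>g ` space M. norm x \<le> K" using g(3) unfolding bounded_iff by blast
  then show ?thesis using that[of g K] g f cls_eq_iff[OF f g(2)] by auto
qed

text \<open>An element dominated by a limit of bounded functions is approximated by its truncations.\<close>

lemma lattice_ideal_closure_Linf:
  assumes Linf: "Linf M \<PP> \<subseteq> LPhi M \<PP> \<Phi>"
  shows "lattice_ideal M \<PP> (LPhi M \<PP> \<Phi>) (norm_closure M \<PP> \<Phi> (Linf M \<PP>))"
proof -
  interpret closed_subspace M \<PP> \<Phi> "norm_closure M \<PP> \<Phi> (Linf M \<PP>)"
    by (rule closed_subspace_norm_closure[OF vector_subspace_Linf[OF Linf]])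
  have L0: "Linf M \<PP> \<subseteq> L0 M \<PP>" using Linf by (auto simp: LPhi_def)
  show ?thesis
    unfolding lattice_ideal_iff
  proof (intro allI impI)
    fix f g assume f: "f \<in> borel_measurable M" and g: "g \<in> FC" and le: "\<forall>\<^sub>F \<omega> in qs. \<bar>f \<omega>\<bar> \<le> \<bar>g \<omega>\<bar>"
    obtain m where "lball m g" using fn_lball[OF g] by blast
    then have "lball m f" using lball_mono[OF _ le] by blast
    moreover have "\<exists>h\<in>fn M \<PP> (Linf M \<PP>). \<exists>l<\<epsilon>. lball l (\<lambda>\<omega>. f \<omega> - h \<omega>)" if \<epsilon>: "0 < \<epsilon>" for \<epsilon>
    proof -
      obtain b l where b: "b \<in> fn M \<PP> (Linf M \<PP>)" and l: "l < \<epsilon>" "lball l (\<lambda>\<omega>. g \<omega> - b \<omega>)"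
        using g \<epsilon> unfolding fn_norm_closure_iff[OF L0] by blast
      obtain c K where c: "c \<in> borel_measurable M" "\<And>\<omega>. \<omega> \<in> space M \<Longrightarrow> \<bar>c \<omega>\<bar> \<le> K"
        and bc: "\<forall>\<^sub>F \<omega> in qs. b \<omega> = c \<omega>"
        using fn_LinfE[OF b] by blast
      \<comment> \<open>Truncation at the level \<open>\<bar>c\<bar>\<close> instead of a constant:
        quasi surely the error is the positive part of \<open>\<bar>f\<bar> - \<bar>c\<bar>\<close>,
        at most that of \<open>\<bar>g\<bar> - \<bar>c\<bar>\<close> and hence at most
        \<open>\<bar>g - c\<bar>\<close>, while \<open>h\<close> stays bounded by
        \<open>K\<close>.\<close>
      define h where "h \<omega> = max (- \<bar>c \<omega>\<bar>) (min (f \<omega>) \<bar>c \<omega>\<bar>)" for \<omega>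
      have "\<bar>h \<omega>\<bar> \<le> K" if "\<omega> \<in> space M" for \<omega> using c(2)[OF that] by (auto simp: h_def)
      moreover have "h \<in> borel_measurable M" unfolding h_def using f c(1) by measurable
      ultimately have "h \<in> fn M \<PP> (Linf M \<PP>)" by (intro fn_Linf)
      moreover have "\<forall>\<^sub>F \<omega> in qs. \<bar>f \<omega> - h \<omega>\<bar> \<le> \<bar>g \<omega> - b \<omega>\<bar>"
        using le bc
      proof eventually_elim
        fix \<omega> assume "\<bar>f \<omega>\<bar> \<le> \<bar>g \<omega>\<bar>" "b \<omega> = c \<omega>"
        then show "\<bar>f \<omega> - h \<omega>\<bar> \<le> \<bar>g \<omega> - b \<omega>\<bar>"
          unfolding h_def by (auto simp: max_def min_def abs_if split: if_splits)
      qed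
      then have "lball l (\<lambda>\<omega>. f \<omega> - h \<omega>)" by (rule lball_mono[OF l(2)]) simp
      ultimately show ?thesis using l(1) by (intro bexI[of _ h] exI[of _ l] conjI)
    qed
    ultimately show "f \<in> FC" using f unfolding fn_norm_closure_iff[OF L0] by blast
  qed
qed

end

context closed_sublattice
begin

lemma norm_closure_C: "norm_closure M \<PP> \<Phi> \<C> = \<C>"
proof
  have "fn M \<PP> (norm_closure M \<PP> \<Phi> \<C>) \<subseteq> FC"
    using fn_norm_closure_iff[OF C_L0] fn_closed by blast
  then show "norm_closure M \<PP> \<Phi> \<C> \<subseteq> \<C>" using fn_subset_iff[OF norm_closure_subset_L0] by blast
  show "\<C> \<subseteq> norm_closure M \<PP> \<Phi> \<C>"
    using norm_closure_superset vector_subspace_C unfolding vector_subspace_def by blast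
qed

text \<open>Bounded functions are dominated by multiples of the constant 1, which lies in
  \<C>.\<close>

lemma Linf_subset_ideal:
  assumes ideal: "lattice_ideal M \<PP> (LPhi M \<PP> \<Phi>) \<C>" and Linf: "Linf M \<PP> \<subseteq> LPhi M \<PP> \<Phi>"
  shows "Linf M \<PP> \<subseteq> \<C>"
proof -
  have "Linf M \<PP> \<subseteq> L0 M \<PP>" using Linf by (auto simp: LPhi_def)
  moreover have "fn M \<PP> (Linf M \<PP>) \<subseteq> FC"
  proof
    fix f assume f: "f \<in> fn M \<PP> (Linf M \<PP>)"
    obtain g K where g: "\<And>\<omega>. \<omega> \<in> space M \<Longrightarrow> \<bar>g \<omega>\<bar> \<le> K" "\<forall>\<^sub>F \<omega> in qs. f \<omega> = g \<omega>"
      using fn_LinfE[OF f] by blast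
    have "f \<in> borel_measurable M" using f by (simp add: fn_def)
    moreover have "(\<lambda>\<omega>. K * 1) \<in> FC" by (intro fn_scale fn_one)
    moreover have "\<forall>\<^sub>F \<omega> in qs. \<bar>f \<omega>\<bar> \<le> \<bar>K * 1\<bar>"
      using g(2) eventually_qs_space by eventually_elim (use g(1) in fastforce)
    ultimately show "f \<in> FC" by (rule ideal_fn[OF ideal])
  qed
  ultimately show ?thesis using fn_subset_iff by blast
qed

end

lemma norm_closure_mono: "A \<subseteq> B \<Longrightarrow> norm_closure M \<PP> \<Phi> A \<subseteq> norm_closure M \<PP> \<Phi> B"
  unfolding norm_closure_def by blast

theorem proposition4p10:
  fixes M :: "'a measure"
    and \<PP> :: "'a measure set"
    and \<Phi> :: "'a measure \<Rightarrow> real \<Rightarrow> ennreal"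
    and \<H> \<C> :: "('a \<Rightarrow> real) set set"
  assumes "\<PP> \<noteq> {}"
    and "\<And>P. P \<in> \<PP> \<Longrightarrow> prob_space P \<and> sets P = sets M"
    and "\<And>P. P \<in> \<PP> \<Longrightarrow> orlicz_function (\<Phi> P)"
    and "Linf M \<PP> \<subseteq> LPhi M \<PP> \<Phi>"
    and "vector_sublattice M \<PP> (LPhi M \<PP> \<Phi>) \<H>"
    and "qs_one M \<PP> \<in> \<H>"
    and "generates M \<PP> \<H>"
    and "\<C> = norm_closure M \<PP> \<Phi> \<H>"
  defines "stmt1 \<equiv> dedekind_sigma_complete \<PP> \<C> \<and> equivalent M (measure ` \<PP>) (ca_sigma_plus M \<PP> \<C>)"
    and "stmt2 \<equiv> dedekind_sigma_complete \<PP> \<C> \<and> ca_cont M \<PP> \<Phi> \<C> = ca_sigma M \<PP> \<C>"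
    and "stmt3 \<equiv> lattice_ideal M \<PP> (LPhi M \<PP> \<Phi>) \<C>"
    and "stmt4 \<equiv> \<C> = norm_closure M \<PP> \<Phi> (Linf M \<PP>)"
  shows "(stmt1 \<longleftrightarrow> stmt2) \<and> (stmt2 \<longleftrightarrow> stmt3) \<and> (\<H> \<subseteq> Linf M \<PP> \<longrightarrow> (stmt3 \<longleftrightarrow> stmt4))"
proof -
  interpret robust_orlicz M \<PP> \<Phi> using assms(1-3) by unfold_locales
  interpret closed_sublattice M \<PP> \<Phi> \<C>
    unfolding assms(8) by (rule closed_sublattice_norm_closure[OF assms(5,6)])
  have H_C: "\<H> \<subseteq> \<C>"
    using norm_closure_superset assms(5,8) by (auto simp: vector_sublattice_def vector_subspace_def)
  have "stmt3 \<Longrightarrow> stmt2"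
    unfolding stmt2_def stmt3_def
    by (intro conjI dedekind_sigma_complete_if_ideal ca_cont_eq_ca_sigma_if_ideal)
  moreover have "stmt2 \<Longrightarrow> stmt1"
    unfolding stmt1_def stmt2_def by (intro conjI equivalent_if_ca_cont_eq_ca_sigma) auto
  moreover have "stmt1 \<Longrightarrow> stmt3"
  proof -
    assume stmt1
    then have "dedekind_sigma_complete \<PP> \<C>" "dominated M (measure ` \<PP>) (ca_sigma_plus M \<PP> \<C>)"
      by (auto simp: stmt1_def equivalent_def)
    moreover have "fn M \<PP> \<H> \<subseteq> fn M \<PP> \<C>" using H_C by (auto simp: fn_def)
    ultimately show stmt3
      unfolding stmt3_def lattice_ideal_iff using ideal_if_equivalent[OF _ _ assms(7)] by blast
  qed
  moreover have "stmt4 \<Longrightarrow> stmt3"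
    unfolding stmt3_def stmt4_def using lattice_ideal_closure_Linf[OF assms(4)] by simp
  moreover have "stmt4" if stmt3 and H: "\<H> \<subseteq> Linf M \<PP>"
    unfolding stmt4_def
  proof
    \<comment> \<open>Boundedness of the elements of \<H> enters in this inclusion; the reverse one
      combines the ideal property with closedness of \<C>.\<close>
    show "\<C> \<subseteq> norm_closure M \<PP> \<Phi> (Linf M \<PP>)"
      unfolding assms(8) by (rule norm_closure_mono[OF H])
    have "Linf M \<PP> \<subseteq> \<C>" using that assms(4) by (simp add: stmt3_def Linf_subset_ideal)
    then have "norm_closure M \<PP> \<Phi> (Linf M \<PP>) \<subseteq> norm_closure M \<PP> \<Phi> \<C>" by (rule norm_closure_mono)
    then show "norm_closure M \<PP> \<Phi> (Linf M \<PP>) \<subseteq> \<C>" by (simp only: norm_closure_C)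
  qed
  ultimately show ?thesis by blast
qed

end
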